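(* Consider the mixed-integer nonlinear program (MINLP) $\min_{x\in X,\,y\in Y} f(x,y)$ subject to $g(x,y)\le 0$, $h(x,y)=0$, and suppose that: (1) $Y=\bar Y\cap\mathbb{Z}^{n_y}$, where $X\subset\mathbb{R}^{n_x}$ and $\bar Y\subset\mathbb{R}^{n_y}$ are closed convex polyhedral sets; $f:\mathbb{R}^{n_x}\times\mathbb{R}^{n_y}\to\mathbb{R}$, $g:\mathbb{R}^{n_x}\times\mathbb{R}^{n_y}\to\mathbb{R}^{n_g}$, $h:\mathbb{R}^{n_x}\times\mathbb{R}^{n_y}\to\mathbb{R}^{n_h}$ are at least twice continuously differentiable; and $Y$ is finite; (2) for all $y\in Y$, the Mangasarian-Fromovitz constraint qualification holds at the solution $x^\star$ of the problem $\mathrm{NLP}(y)$: $\min_{x\in X} f(x,y)$ s.t. $g(x,y)\le0$, $h(x,y)=0$; (3) $h$ is affine, and $g_1,\dots,g_{n_g}$ and $f$ are convex on $X\times\bar Y$. Then the S-B-MIQP algorithm enhanced with the gradient correction and amplification procedure for the Benders cuts, and correction of the infeasibility cuts (described in the context), terminates in a finite number of iterations and returns either a global optimal solution of the MINLP or a certificate of infeasibility.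
   Context: Notation. For a vector-valued $\phi$, $\nabla\phi$ is the transpose of the Jacobian. $\phi_{\mathrm L}(x,y;\bar x,\bar y)=\phi(\bar x,\bar y)+\nabla\phi(\bar x,\bar y)^\top\binom{x-\bar x}{y-\bar y}$ is the linearization of $\phi$ at $(\bar x,\bar y)$. $W$ is a symmetric positive definite weight matrix and $\|v\|_W^2=v^\top Wv$. Value function. $J(y)=\min_{x\in X}\{f(x,y): g(x,y)\le0,\ h(x,y)=0\}$ is the optimal value of $\mathrm{NLP}(y)$, with $J(y)=+\infty$ if $\mathrm{NLP}(y)$ is infeasible. For $\tilde y\in Y$, consider the lifted problem $\min_{x\in X,\,y\in Y} f(x,y)$ s.t. $g(x,y)\le0$, $h(x,y)=0$, $y-\tilde y=0$, with locally optimal solution $(x^\star,\tilde y)$ and Lagrange multipliers $\lambda,\mu,\mu_{\tilde y}$ of the three groups of constraints respectively; the KKT conditions are written as $\nabla_x f+\nabla_x g\,\lambda+\nabla_x h\,\mu=0$, $\nabla_y f+\nabla_y g\,\lambda+\nabla_y h\,\mu=-\mu_{\tilde y}$, $g\le0$, $h=0$, $\lambda\ge0$, $\lambda_i g_i=0$ for $i=1,\dots,n_g$, all evaluated at $(x^\star,\tilde y)$. One sets $\nabla J(\tilde y):=-\mu_{\tilde y}$. Feasibility problem $\mathrm{FNLP}(\hat y,y_b)$: $\min_{x\in X,\,y\in\bar Y}\|y-\hat y\|_2^2$ s.t. $g(x,y)\le0$, $h(x,y)=0$ and, only if a feasible best point $y_b$ is available, $\|y_b-y\|_2^2\le\|y_b-\hat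 y\|_2^2$. The $y$-component of its solution is denoted $\bar y$. Bookkeeping. $y_k\in Y$ is the integer point processed at iteration $k$. $\mathbb{T}_k$ (resp. $\mathbb{S}_k$) is the set of indices $i\le k$ for which $\mathrm{NLP}(y_i)$ is feasible (resp. infeasible). For $i\in\mathbb{T}_k$, $x_i$ is the solution of $\mathrm{NLP}(y_i)$; for $i\in\mathbb{S}_k$, $(x_i,\bar y_i)$ is the solution of the feasibility problem. The best index is $b(k)\in\arg\min_{i\in\mathbb{T}_k}J(y_i)$ if $\mathbb{T}_k\ne\emptyset$, and $b(k)\in\arg\min_{i\in\mathbb{S}_k}\|\bar y_i-y_i\|_2^2$ otherwise; ties are broken by the smallest index. Let $\alpha\in[0,1)$ be a user-chosen parameter and $\bar J_k=\alpha J(y_{b(k)})+(1-\alpha)\mathrm{LB}$ with the current lower bound $\mathrm{LB}$. Corrections at iteration $k$. Gradient correction: for $i\in\mathbb{T}_k$, $g^{\mathrm{corr}}_{(i,k)}$ is the minimizer of $\frac12\|g-\nabla J(y_i)\|_W^2$ over all $g$ with $J(y_i)+g^\top(y_{b(k)}-y_i)\le J(y_{b(k)})$. Amplification: with a constant $\rho\ge1$, the gradient used in the cut is $\tilde g_{(i,k)}=\rho\, g^{\mathrm{corr}}_{(i,k)}$ if the gradient had to be corrected (i.e. $J(y_i)+\nabla J(y_i)^\top(y_{b(k)}-y_i)>J(y_{b(k)})$), and $\tilde g_{(i,k)}=\nabla J(y_i)$ otherwise. Infeasibility-cut correction: for $i\in\mathbb{S}_k$, if $\mathbb{T}_k\neq\emptyset$,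 $\tilde n_{(i,k)}$ is the minimizer of $\frac12\|n-(y_i-\bar y_i)\|_W^2$ over all $n$ with $n^\top(y_{b(k)}-\bar y_i)\le0$; if $\mathbb{T}_k=\emptyset$, $\tilde n_{(i,k)}=y_i-\bar y_i$. Master problem BR-MIQP at iteration $k$ (with $b=b(k)$ and $B_b$ a symmetric positive semidefinite approximation of the Hessian, with respect to $(x,y)$, of the Lagrangian of the NLP at $(x_b,y_b)$): minimize over $x\in X$, $y\in Y$ the function $f_{\mathrm L}(x,y;x_b,y_b)+\frac12\binom{x-x_b}{y-y_b}^\top B_b\binom{x-x_b}{y-y_b}$ subject to $g_{\mathrm L}(x,y;x_b,y_b)\le0$, $h_{\mathrm L}(x,y;x_b,y_b)=0$, $J(y_i)+\tilde g_{(i,k)}^\top(y-y_i)\le\bar J_k$ for $i\in\mathbb{T}_k$, and $\tilde n_{(i,k)}^\top(y-\bar y_i)\le0$ for $i\in\mathbb{S}_k$. Master problem LB-MILP at iteration $k$: minimize $\eta$ over $\eta\in\mathbb{R}$, $x\in X$, $y\in Y$ subject to (only if $b\in\mathbb{T}_k$) $\eta\ge f_{\mathrm L}(x,y;x_b,y_b)$, $0\ge g_{\mathrm L}(x,y;x_b,y_b)$, $0=h_{\mathrm L}(x,y;x_b,y_b)$; $\eta\ge J(y_i)+\tilde g_{(i,k)}^\top(y-y_i)$ for $i\in\mathbb{T}_k\setminus\{b\}$; and $0\ge\tilde n_{(i,k)}^\top(y-\bar y_i)$ for $i\in\mathbb{S}_k$. Its objective value at a solution is $V_{\mathrm{MILP}}$.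 Enhanced S-B-MIQP algorithm. Initialize with $y_0\in Y$, $k=0$, $b(0)=0$, $\mathbb{S}_{-1}=\mathbb{T}_{-1}=\emptyset$, $\mathrm{UB}=+\infty$, $\mathrm{LB}=\min_{y\in\bar Y}J(y)$ (the objective of the continuous relaxation of the MINLP). While $\mathrm{LB}<\mathrm{UB}$: (i) Solve $\mathrm{NLP}(y_k)$. If feasible, store $(k,x_k,y_k,J(y_k),\nabla J(y_k))$, set $\mathbb{T}_k=\mathbb{T}_{k-1}\cup\{k\}$, $\mathbb{S}_k=\mathbb{S}_{k-1}$, and if $J(y_k)<\mathrm{UB}$ set $\mathrm{UB}=J(y_k)$. If infeasible, solve $\mathrm{FNLP}(y_k,y_b)$ with the current feasible best point $y_b$ (if any), store its solution with $\bar y_k$, set $\mathbb{S}_k=\mathbb{S}_{k-1}\cup\{k\}$, $\mathbb{T}_k=\mathbb{T}_{k-1}$. (ii) Compute $b(k)$ and the modified data $\tilde g_{(i,k)}$, $\tilde n_{(i,k)}$. (iii) If $k-b(k)\le1$, solve BR-MIQP and, if feasible, let $\tilde y$ be the $y$-component of its solution. (iv) If $k-b(k)>1$ or BR-MIQP is infeasible, solve LB-MILP. If it is infeasible, set $\mathrm{LB}=+\infty$. Otherwise let $\tilde y$ be the $y$-component of its solution, and if $V_{\mathrm{MILP}}>\mathrm{LB}$ set $\mathrm{LB}=V_{\mathrm{MILP}}$. (v) Set $y_{k+1}=\tilde y$, $b(k+1)=b(k)$, $k\leftarrow k+1$. The solution returned is the incumbent $(x_b,y_b)$, i.e. the best feasible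 point found, with objective $\mathrm{UB}$. The certificate of infeasibility is termination with $\mathrm{LB}=\mathrm{UB}=+\infty$, by which the MINLP is classified as infeasible.
   Formalization: KKT stationarity in x uses the normal cone of X instead of a zero gradient; the MFCQ direction must be feasible for X; that a run never gets stuck is claimed only if each feasible subproblem that is called attains its minimum. *)

theory Defs
  imports "HOL-Analysis.Analysis"
begin

section \<open>Smoothness, gradients and linearizations\<close>

definition grad :: "('a::real_inner \<Rightarrow> real) \<Rightarrow> 'a \<Rightarrow> 'a" where
  "grad \<phi> z = (THE D. GDERIV \<phi> z :> D)"

definition C2 :: "('a::euclidean_space \<Rightarrow> real) \<Rightarrow> bool" where
  "C2 \<phi> \<longleftrightarrow> (\<exists>(G :: 'a \<Rightarrow> 'a) (H :: 'a \<Rightarrow> 'a \<Rightarrow>\<^sub>L 'a).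
      (\<forall>z. GDERIV \<phi> z :> G z) \<and>
      (\<forall>z. (G has_derivative blinfun_apply (H z)) (at z)) \<and>
      continuous_on UNIV H)"

definition affine_map :: "('a::real_inner \<Rightarrow> real) \<Rightarrow> bool" where
  "affine_map \<phi> \<longleftrightarrow> (\<exists>a c. \<forall>z. \<phi> z = a \<bullet> z + c)"

definition lin :: "('a::real_inner \<Rightarrow> real) \<Rightarrow> 'a \<Rightarrow> 'a \<Rightarrow> real" where
  "lin \<phi> zbar z = \<phi> zbar + grad \<phi> zbar \<bullet> (z - zbar)"

definition wnorm2 :: "real^'n^'n \<Rightarrow> real^'n \<Rightarrow> real" where
  "wnorm2 W v = v \<bullet> (W *v v)"

definition sym_pos_def :: "real^'n^'n \<Rightarrow> bool" where
  "sym_pos_def W \<longleftrightarrow> transpose W = W \<and> (\<forall>v. v \<noteq> 0 \<longrightarrow> v \<bullet> (W *v v) > 0)"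

text \<open>Quadratic forms on the product space are given by operators rather than by matrices.\<close>

definition sym_pos_semidef :: "('a::real_inner \<Rightarrow> 'a) \<Rightarrow> bool" where
  "sym_pos_semidef B \<longleftrightarrow>
     linear B \<and> (\<forall>u v. B u \<bullet> v = u \<bullet> B v) \<and> (\<forall>u. u \<bullet> B u \<ge> 0)"


section \<open>The mixed-integer program and its subproblems\<close>

text \<open>
  The components of the inequality and equality constraints are indexed by the natural numbers
  below \<open>n_ineq\<close> and \<open>n_eq\<close>, so that either group may be empty.
\<close>

record ('nx::finite, 'ny::finite) minlp =
  Xset :: "(real^'nx) set"
  Yrel :: "(real^'ny) set"
  obj :: "(real^'nx) \<times> (real^'ny) \<Rightarrow> real"
  n_ineq :: nat
  ineq :: "nat \<Rightarrow> (real^'nx) \<times> (real^'ny) \<Rightarrow> real"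
  n_eq :: nat
  eqc :: "nat \<Rightarrow> (real^'nx) \<times> (real^'ny) \<Rightarrow> real"

definition Yint :: "('nx::finite, 'ny::finite) minlp \<Rightarrow> (real^'ny) set" where
  "Yint P = {y \<in> Yrel P. \<forall>j. y $ j \<in> \<int>}"

definition constr :: "('nx::finite, 'ny::finite) minlp \<Rightarrow> (real^'nx) \<times> (real^'ny) \<Rightarrow> bool" where
  "constr P z \<longleftrightarrow> (\<forall>i<n_ineq P. ineq P i z \<le> 0) \<and> (\<forall>j<n_eq P. eqc P j z = 0)"

definition minlp_feasible ::
    "('nx::finite, 'ny::finite) minlp \<Rightarrow> (real^'nx) \<times> (real^'ny) \<Rightarrow> bool" where
  "minlp_feasible P z \<longleftrightarrow> fst z \<in> Xset P \<and> snd z \<in> Yint P \<and> constr P z"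

definition nlp_feasible ::
    "('nx::finite, 'ny::finite) minlp \<Rightarrow> real^'ny \<Rightarrow> real^'nx \<Rightarrow> bool" where
  "nlp_feasible P y x \<longleftrightarrow> x \<in> Xset P \<and> constr P (x, y)"

definition nlp_solution ::
    "('nx::finite, 'ny::finite) minlp \<Rightarrow> real^'ny \<Rightarrow> real^'nx \<Rightarrow> bool" where
  "nlp_solution P y x \<longleftrightarrow> is_arg_min (\<lambda>x. obj P (x, y)) (nlp_feasible P y) x"

text \<open>The infimum over the empty set is \<open>\<infinity>\<close>, the value of an infeasible problem.\<close>

definition J :: "('nx::finite, 'ny::finite) minlp \<Rightarrow> real^'ny \<Rightarrow> ereal" where
  "J P y = (INF x\<in>{x. nlp_feasible P y x}. ereal (obj P (x, y)))"

text \<open>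
  Mangasarian-Fromovitz for \<open>NLP(y)\<close>, which contains the constraint \<open>x \<in> X\<close>: the strict descent
  direction has to be a feasible direction of the polyhedron \<open>X\<close>. At interior points of \<open>X\<close> this
  requirement is void and the condition is the textbook one.
\<close>

definition mfcq :: "('nx::finite, 'ny::finite) minlp \<Rightarrow> real^'ny \<Rightarrow> real^'nx \<Rightarrow> bool" where
  "mfcq P y x \<longleftrightarrow>
     (\<forall>c :: nat \<Rightarrow> real. (\<Sum>j<n_eq P. c j *\<^sub>R fst (grad (eqc P j) (x, y))) = 0
        \<longrightarrow> (\<forall>j<n_eq P. c j = 0)) \<and>
     (\<exists>d. (\<exists>t>0. x + t *\<^sub>R d \<in> Xset P) \<and>
          (\<forall>j<n_eq P. fst (grad (eqc P j) (x, y)) \<bullet> d = 0) \<and>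
          (\<forall>i<n_ineq P. ineq P i (x, y) = 0 \<longrightarrow> fst (grad (ineq P i) (x, y)) \<bullet> d < 0))"

definition grad_lagrangian ::
    "('nx::finite, 'ny::finite) minlp \<Rightarrow> (nat \<Rightarrow> real) \<Rightarrow> (nat \<Rightarrow> real) \<Rightarrow>
     (real^'nx) \<times> (real^'ny) \<Rightarrow> (real^'nx) \<times> (real^'ny)" where
  "grad_lagrangian P lam mu z =
     grad (obj P) z + (\<Sum>i<n_ineq P. lam i *\<^sub>R grad (ineq P i) z)
                    + (\<Sum>j<n_eq P. mu j *\<^sub>R grad (eqc P j) z)"

text \<open>
  KKT conditions of the lifted problem at \<open>(x, y)\<close>; \<open>muy\<close> is the multiplier of the constraint that
  fixes \<open>y\<close>. The polyhedron \<open>X\<close> enters stationarity in \<open>x\<close> through its normal cone: minus the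
  gradient is normal to \<open>X\<close> at \<open>x\<close>. Every point with \<open>\<nabla>\<^sub>x L = 0\<close> qualifies, and at interior points
  of \<open>X\<close> (in particular for \<open>X = UNIV\<close>) nothing else does. Requiring \<open>\<nabla>\<^sub>x L = 0\<close> throughout would
  leave the problem without multipliers whenever a face of \<open>X\<close> is active with nonzero force.
\<close>

definition kkt ::
    "('nx::finite, 'ny::finite) minlp \<Rightarrow> real^'nx \<Rightarrow> real^'ny \<Rightarrow>
     (nat \<Rightarrow> real) \<Rightarrow> (nat \<Rightarrow> real) \<Rightarrow> real^'ny \<Rightarrow> bool" where
  "kkt P x y lam mu muy \<longleftrightarrow>
     (\<forall>x'\<in>Xset P. fst (grad_lagrangian P lam mu (x, y)) \<bullet> (x' - x) \<ge> 0) \<and>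
     snd (grad_lagrangian P lam mu (x, y)) = - muy \<and>
     nlp_feasible P y x \<and>
     (\<forall>i<n_ineq P. lam i \<ge> 0 \<and> lam i * ineq P i (x, y) = 0)"


section \<open>The algorithm\<close>

record ('nx::finite, 'ny::finite) params =
  weight :: "real^'ny^'ny"
  amp :: real
  alph :: real
  hess :: "nat \<Rightarrow> (real^'nx) \<times> (real^'ny) \<Rightarrow> (real^'nx) \<times> (real^'ny)"

text \<open>
  An iteration consists of two transitions: \<open>Evaluate\<close> tests the loop guard, solves \<open>NLP(y\<^sub>k)\<close> or the
  feasibility problem and recomputes the best index; \<open>Master\<close> solves the master problems and
  increments \<open>k\<close>.
\<close>

datatype phase = Evaluate | Master

text \<open>
  The arrays \<open>ys\<close>, \<open>xs\<close>, \<open>ybars\<close>, \<open>dJs\<close> are meaningful at the indices written so far; \<open>Ts\<close> and \<open>Ss\<close> are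
  the index sets of feasible and infeasible iterations.
\<close>

record ('nx::finite, 'ny::finite) state =
  phase :: phase
  iter :: nat
  ys :: "nat \<Rightarrow> real^'ny"
  xs :: "nat \<Rightarrow> real^'nx"
  ybars :: "nat \<Rightarrow> real^'ny"
  dJs :: "nat \<Rightarrow> real^'ny"
  Ts :: "nat set"
  Ss :: "nat set"
  best :: nat
  LB :: ereal
  UB :: ereal

definition fnlp_feasible ::
    "('nx::finite, 'ny::finite) minlp \<Rightarrow> ('nx, 'ny) state \<Rightarrow> (real^'nx) \<times> (real^'ny) \<Rightarrow> bool" where
  "fnlp_feasible P s z \<longleftrightarrow>
     fst z \<in> Xset P \<and> snd z \<in> Yrel P \<and> constr P z \<and>
     (Ts s \<noteq> {} \<longrightarrow>
        (norm (ys s (best s) - snd z))\<^sup>2 \<le> (norm (ys s (best s) - ys s (iter s)))\<^sup>2)"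

definition fnlp_solution ::
    "('nx::finite, 'ny::finite) minlp \<Rightarrow> ('nx, 'ny) state \<Rightarrow> (real^'nx) \<times> (real^'ny) \<Rightarrow> bool" where
  "fnlp_solution P s z \<longleftrightarrow>
     is_arg_min (\<lambda>z. (norm (snd z - ys s (iter s)))\<^sup>2) (fnlp_feasible P s) z"

definition best_index :: "('nx::finite, 'ny::finite) minlp \<Rightarrow> ('nx, 'ny) state \<Rightarrow> nat" where
  "best_index P s =
     (if Ts s \<noteq> {}
      then LEAST i. is_arg_min (\<lambda>i. J P (ys s i)) (\<lambda>i. i \<in> Ts s) i
      else LEAST i. is_arg_min (\<lambda>i. (norm (ybars s i - ys s i))\<^sup>2) (\<lambda>i. i \<in> Ss s) i)"

definition supports_best ::
    "('nx::finite, 'ny::finite) minlp \<Rightarrow> ('nx, 'ny) state \<Rightarrow> nat \<Rightarrow> real^'ny \<Rightarrow> bool" where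
  "supports_best P s i v \<longleftrightarrow>
     J P (ys s i) + ereal (v \<bullet> (ys s (best s) - ys s i)) \<le> J P (ys s (best s))"

text \<open>
  For a positive definite weight, \<open>arg_min\<close> below picks the unique minimizer, namely a projection
  onto a nonempty closed half-space or onto the whole space.
\<close>

definition g_corr ::
    "('nx::finite, 'ny::finite) minlp \<Rightarrow> ('nx, 'ny) params \<Rightarrow> ('nx, 'ny) state \<Rightarrow> nat \<Rightarrow> real^'ny" where
  "g_corr P A s i = arg_min (\<lambda>v. 1/2 * wnorm2 (weight A) (v - dJs s i)) (supports_best P s i)"

definition g_cut ::
    "('nx::finite, 'ny::finite) minlp \<Rightarrow> ('nx, 'ny) params \<Rightarrow> ('nx, 'ny) state \<Rightarrow> nat \<Rightarrow> real^'ny" where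
  "g_cut P A s i =
     (if supports_best P s i (dJs s i) then dJs s i else amp A *\<^sub>R g_corr P A s i)"

definition n_cut ::
    "('nx::finite, 'ny::finite) params \<Rightarrow> ('nx, 'ny) state \<Rightarrow> nat \<Rightarrow> real^'ny" where
  "n_cut A s i =
     (if Ts s \<noteq> {}
      then arg_min (\<lambda>n. 1/2 * wnorm2 (weight A) (n - (ys s i - ybars s i)))
                   (\<lambda>n. n \<bullet> (ys s (best s) - ybars s i) \<le> 0)
      else ys s i - ybars s i)"

definition zbest :: "('nx::finite, 'ny::finite) state \<Rightarrow> (real^'nx) \<times> (real^'ny)" where
  "zbest s = (xs s (best s), ys s (best s))"

definition Jbar ::
    "('nx::finite, 'ny::finite) minlp \<Rightarrow> ('nx, 'ny) params \<Rightarrow> ('nx, 'ny) state \<Rightarrow> ereal" where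
  "Jbar P A s = ereal (alph A) * J P (ys s (best s)) + ereal (1 - alph A) * LB s"

definition lin_cons ::
    "('nx::finite, 'ny::finite) minlp \<Rightarrow> ('nx, 'ny) state \<Rightarrow> (real^'nx) \<times> (real^'ny) \<Rightarrow> bool" where
  "lin_cons P s z \<longleftrightarrow>
     (\<forall>i<n_ineq P. lin (ineq P i) (zbest s) z \<le> 0) \<and>
     (\<forall>j<n_eq P. lin (eqc P j) (zbest s) z = 0)"

definition br_feasible ::
    "('nx::finite, 'ny::finite) minlp \<Rightarrow> ('nx, 'ny) params \<Rightarrow> ('nx, 'ny) state \<Rightarrow>
     (real^'nx) \<times> (real^'ny) \<Rightarrow> bool" where
  "br_feasible P A s z \<longleftrightarrow>
     fst z \<in> Xset P \<and> snd z \<in> Yint P \<and> lin_cons P s z \<and>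
     (\<forall>i\<in>Ts s. J P (ys s i) + ereal (g_cut P A s i \<bullet> (snd z - ys s i)) \<le> Jbar P A s) \<and>
     (\<forall>i\<in>Ss s. n_cut A s i \<bullet> (snd z - ybars s i) \<le> 0)"

definition br_solution ::
    "('nx::finite, 'ny::finite) minlp \<Rightarrow> ('nx, 'ny) params \<Rightarrow> ('nx, 'ny) state \<Rightarrow>
     (real^'nx) \<times> (real^'ny) \<Rightarrow> bool" where
  "br_solution P A s z \<longleftrightarrow>
     is_arg_min (\<lambda>z. lin (obj P) (zbest s) z
                     + 1/2 * ((z - zbest s) \<bullet> hess A (best s) (z - zbest s)))
                (br_feasible P A s) z"

text \<open>
  The epigraph variable \<open>\<eta>\<close> is extended real. As soon as one iteration was feasible, a finite lower
  bound on \<open>\<eta>\<close> is present and minimal values are real. Before that, nothing bounds \<open>\<eta>\<close> from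
  below: the optimal value is \<open>-\<infinity>\<close> and any feasible \<open>(x, y)\<close> is a solution.
\<close>

definition milp_feasible ::
    "('nx::finite, 'ny::finite) minlp \<Rightarrow> ('nx, 'ny) params \<Rightarrow> ('nx, 'ny) state \<Rightarrow>
     ereal \<times> (real^'nx) \<times> (real^'ny) \<Rightarrow> bool" where
  "milp_feasible P A s w \<longleftrightarrow> (case w of (\<eta>, z) \<Rightarrow>
     fst z \<in> Xset P \<and> snd z \<in> Yint P \<and>
     (best s \<in> Ts s \<longrightarrow> ereal (lin (obj P) (zbest s) z) \<le> \<eta> \<and> lin_cons P s z) \<and>
     (\<forall>i\<in>Ts s - {best s}.
        J P (ys s i) + ereal (g_cut P A s i \<bullet> (snd z - ys s i)) \<le> \<eta>) \<and>
     (\<forall>i\<in>Ss s. n_cut A s i \<bullet> (snd z - ybars s i) \<le> 0))"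

definition milp_solution ::
    "('nx::finite, 'ny::finite) minlp \<Rightarrow> ('nx, 'ny) params \<Rightarrow> ('nx, 'ny) state \<Rightarrow>
     ereal \<times> (real^'nx) \<times> (real^'ny) \<Rightarrow> bool" where
  "milp_solution P A s w \<longleftrightarrow> is_arg_min fst (milp_feasible P A s) w"

definition initial :: "('nx::finite, 'ny::finite) minlp \<Rightarrow> ('nx, 'ny) state \<Rightarrow> bool" where
  "initial P s \<longleftrightarrow>
     phase s = Evaluate \<and> iter s = 0 \<and> ys s 0 \<in> Yint P \<and> best s = 0 \<and>
     Ts s = {} \<and> Ss s = {} \<and> UB s = \<infinity> \<and> LB s = (INF y\<in>Yrel P. J P y)"

definition refresh ::
    "('nx::finite, 'ny::finite) minlp \<Rightarrow> ('nx, 'ny) state \<Rightarrow> ('nx, 'ny) state" where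
  "refresh P s = s\<lparr>best := best_index P s, phase := Master\<rparr>"

definition advance ::
    "real^'ny \<Rightarrow> ('nx::finite, 'ny::finite) state \<Rightarrow> ('nx, 'ny) state" where
  "advance y s =
     s\<lparr>ys := (ys s)(Suc (iter s) := y), iter := Suc (iter s), phase := Evaluate\<rparr>"

definition needs_milp ::
    "('nx::finite, 'ny::finite) minlp \<Rightarrow> ('nx, 'ny) params \<Rightarrow> ('nx, 'ny) state \<Rightarrow> bool" where
  "needs_milp P A s \<longleftrightarrow> iter s - best s > 1 \<or> (\<nexists>z. br_feasible P A s z)"

text \<open>
  Solutions and multipliers need not be unique, so the algorithm is a transition relation. In the
  last rule no new integer point is available; the loop guard fails afterwards.
\<close>

inductive step ::
    "('nx::finite, 'ny::finite) minlp \<Rightarrow> ('nx, 'ny) params \<Rightarrow>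
     ('nx, 'ny) state \<Rightarrow> ('nx, 'ny) state \<Rightarrow> bool"
  for P A where
  nlp_feas:
    "\<lbrakk>phase s = Evaluate; LB s < UB s; nlp_solution P (ys s (iter s)) x;
      kkt P x (ys s (iter s)) lam mu muy\<rbrakk>
     \<Longrightarrow> step P A s (refresh P
           (s\<lparr>xs := (xs s)(iter s := x), dJs := (dJs s)(iter s := - muy),
              Ts := insert (iter s) (Ts s),
              UB := (if J P (ys s (iter s)) < UB s then J P (ys s (iter s)) else UB s)\<rparr>))"
| nlp_infeas:
    "\<lbrakk>phase s = Evaluate; LB s < UB s; \<nexists>x. nlp_feasible P (ys s (iter s)) x;
      fnlp_solution P s (x, yb)\<rbrakk>
     \<Longrightarrow> step P A s (refresh P
           (s\<lparr>xs := (xs s)(iter s := x), ybars := (ybars s)(iter s := yb),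
              Ss := insert (iter s) (Ss s)\<rparr>))"
| br:
    "\<lbrakk>phase s = Master; iter s - best s \<le> 1; br_solution P A s (x, y)\<rbrakk>
     \<Longrightarrow> step P A s (advance y s)"
| milp:
    "\<lbrakk>phase s = Master; needs_milp P A s; milp_solution P A s (V, x, y)\<rbrakk>
     \<Longrightarrow> step P A s (advance y (s\<lparr>LB := (if V > LB s then V else LB s)\<rparr>))"
| milp_infeas:
    "\<lbrakk>phase s = Master; needs_milp P A s; \<nexists>w. milp_feasible P A s w\<rbrakk>
     \<Longrightarrow> step P A s (advance y (s\<lparr>LB := \<infinity>\<rparr>))"

definition reachable ::
    "('nx::finite, 'ny::finite) minlp \<Rightarrow> ('nx, 'ny) params \<Rightarrow> ('nx, 'ny) state \<Rightarrow> bool" where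
  "reachable P A s \<longleftrightarrow> (\<exists>s0. initial P s0 \<and> (step P A)\<^sup>*\<^sup>* s0 s)"

definition terminated :: "('nx::finite, 'ny::finite) state \<Rightarrow> bool" where
  "terminated s \<longleftrightarrow> phase s = Evaluate \<and> \<not> LB s < UB s"

text \<open>
  Writing \<open>min\<close> for a subproblem presupposes that the minimum is attained as soon as the subproblem
  is feasible. This is that convention for exactly the subproblems called in state \<open>s\<close>. It is not
  a consequence of convexity, since \<open>X\<close> may be unbounded.
\<close>

definition subproblems_attained ::
    "('nx::finite, 'ny::finite) minlp \<Rightarrow> ('nx, 'ny) params \<Rightarrow> ('nx, 'ny) state \<Rightarrow> bool" where
  "subproblems_attained P A s \<longleftrightarrow> (case phase s of
     Evaluate \<Rightarrow>
       (if \<exists>x. nlp_feasible P (ys s (iter s)) x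
        then \<exists>x. nlp_solution P (ys s (iter s)) x
        else (\<exists>z. fnlp_feasible P s z) \<longrightarrow> (\<exists>z. fnlp_solution P s z))
   | Master \<Rightarrow>
       (if needs_milp P A s
        then (\<exists>w. milp_feasible P A s w) \<longrightarrow> (\<exists>w. milp_solution P A s w)
        else \<exists>z. br_solution P A s z))"

end

theory Submission
  imports Defs
begin

text \<open>
  By convexity and the KKT conditions, the Benders cuts at feasible iterates are valid for every
  feasible point of the continuous relaxation, and each infeasibility cut is the obtuse-angle
  inequality of a projection onto the convex set of all \<open>y\<close> that admit a feasible \<open>x\<close>. Both therefore
  already hold at the best point: neither correction nor amplification ever changes a cut. Hence
  LB-MILP is a relaxation and \<open>LB\<close> stays a lower bound. An integer point visited before cannot be
  proposed again without closing the gap: infeasible ones are strictly cut off, in BR-MIQP a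
  feasible one violates its own cut because \<open>Jbar < UB\<close>, and in LB-MILP it forces \<open>\<eta> \<ge> UB\<close>, for the
  best point by stationarity. As \<open>Y\<close> is finite, the loop ends. Multipliers exist by Farkas' lemma,
  which needs the Mangasarian-Fromovitz direction only for the inequality constraints, since \<open>X\<close> is
  polyhedral and \<open>h\<close> is affine.
\<close>

section \<open>Gradients\<close>

text \<open>\<open>grad\<close> is a definite description, so uniqueness is the point: the
  derivative determines its representing vector because the inner product is nondegenerate.\<close>

lemma gderiv_grad:
  assumes "GDERIV \<phi> z :> D"
  shows "GDERIV \<phi> z :> grad \<phi> z"
proof -
  have "D' = D" if "GDERIV \<phi> z :> D'" for D'
  proof -
    have "(\<lambda>h. h \<bullet> D') = (\<lambda>h. h \<bullet> D)"
      using that assms has_derivative_unique unfolding gderiv_def by blast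
    then show ?thesis
      by (metis inner_commute vector_eq_rdot)
  qed
  then show ?thesis
    unfolding grad_def using assms by (rule_tac theI) auto
qed

lemma C2_gderiv: "C2 \<phi> \<Longrightarrow> GDERIV \<phi> z :> grad \<phi> z"
  unfolding C2_def using gderiv_grad by blast

lemma gderiv_line:
  assumes "GDERIV \<phi> z :> G"
  shows "((\<lambda>t. \<phi> (z + t *\<^sub>R d)) has_real_derivative G \<bullet> d) (at 0)"
proof -
  have "((\<lambda>t::real. z + t *\<^sub>R d) has_derivative (\<lambda>t. t *\<^sub>R d)) (at 0)"
    by (auto intro!: derivative_eq_intros)
  moreover have "(\<phi> has_derivative (\<lambda>h. h \<bullet> G)) (at (z + 0 *\<^sub>R d))"
    using assms by (simp add: gderiv_def)
  ultimately have "((\<lambda>t::real. \<phi> (z + t *\<^sub>R d)) has_derivative (\<lambda>t. (t *\<^sub>R d) \<bullet> G)) (at 0)"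
    by (rule has_derivative_compose)
  then show ?thesis
    by (simp add: has_field_derivative_def inner_commute mult_commute_abs)
qed

text \<open>Convexity bounds the difference quotients along the segment from \<open>z\<close> to
  \<open>z'\<close> by \<open>\<phi> z' - \<phi> z\<close> for \<open>t\<close> in (0,1), and the
  bound passes to the limit from the right.\<close>

lemma convex_above_gradient:
  assumes cvx: "convex_on S \<phi>" and G: "GDERIV \<phi> z :> G" and z: "z \<in> S" "z' \<in> S"
  shows "\<phi> z + G \<bullet> (z' - z) \<le> \<phi> z'"
proof -
  let ?q = "\<lambda>t. (\<phi> (z + t *\<^sub>R (z' - z)) - \<phi> z) / t"
  have "(?q \<longlongrightarrow> G \<bullet> (z' - z)) (at 0)"
    using gderiv_line[OF G, of "z' - z"] by (simp add: has_field_derivative_iff)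
  then have "(?q \<longlongrightarrow> G \<bullet> (z' - z)) (at_right 0)"
    by (rule tendsto_mono[rotated]) (simp add: at_le)
  moreover have "eventually (\<lambda>t. ?q t \<le> \<phi> z' - \<phi> z) (at_right 0)"
  proof (rule eventually_at_rightI)
    fix t :: real assume t: "t \<in> {0<..<1}"
    have "\<phi> ((1 - t) *\<^sub>R z + t *\<^sub>R z') \<le> (1 - t) * \<phi> z + t * \<phi> z'"
      using t by (intro convex_onD[OF cvx] z) auto
    moreover have "(1 - t) *\<^sub>R z + t *\<^sub>R z' = z + t *\<^sub>R (z' - z)"
      by (simp add: algebra_simps)
    ultimately show "?q t \<le> \<phi> z' - \<phi> z"
      using t by (simp add: field_simps)
  qed auto
  ultimately have "G \<bullet> (z' - z) \<le> \<phi> z' - \<phi> z"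
    by (rule tendsto_upperbound) simp
  then show ?thesis by simp
qed

text \<open>Meant for the objective and the active constraints: difference quotients with a negative
  limit are eventually negative.\<close>

lemma gderiv_eventually_less:
  assumes G: "GDERIV \<phi> z :> G" and neg: "G \<bullet> d < 0"
  shows "eventually (\<lambda>t. \<phi> (z + t *\<^sub>R d) < \<phi> z) (at_right 0)"
proof -
  let ?q = "\<lambda>t. (\<phi> (z + t *\<^sub>R d) - \<phi> z) / t"
  have "(?q \<longlongrightarrow> G \<bullet> d) (at 0)"
    using gderiv_line[OF G, of d] by (simp add: has_field_derivative_iff)
  then have "(?q \<longlongrightarrow> G \<bullet> d) (at_right 0)"
    by (rule tendsto_mono[rotated]) (simp add: at_le)
  then have "eventually (\<lambda>t. ?q t < 0) (at_right 0)"
    using neg by (rule order_tendstoD)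
  moreover have "eventually (\<lambda>t::real. t > 0) (at_right 0)"
    by (simp add: eventually_at_right_less)
  ultimately show ?thesis
    by eventually_elim (simp add: divide_less_0_iff)
qed

text \<open>Meant for the inactive constraints: continuity along the ray keeps them inactive for
  short steps.\<close>

lemma gderiv_eventually_neg:
  assumes G: "GDERIV \<phi> z :> G" and neg: "\<phi> z < 0"
  shows "eventually (\<lambda>t. \<phi> (z + t *\<^sub>R d) < 0) (at_right 0)"
proof -
  have "((\<lambda>t. \<phi> (z + t *\<^sub>R d)) \<longlongrightarrow> \<phi> z) (at 0)"
    using DERIV_isCont[OF gderiv_line[OF G]] by (simp add: isCont_def)
  then have "((\<lambda>t. \<phi> (z + t *\<^sub>R d)) \<longlongrightarrow> \<phi> z) (at_right 0)"
    by (rule tendsto_mono[rotated]) (simp add: at_le)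
  then show ?thesis
    using neg by (rule order_tendstoD)
qed

lemma affine_map_grad:
  assumes "affine_map \<phi>"
  shows "\<phi> z' = \<phi> z + grad \<phi> z \<bullet> (z' - z)"
proof -
  obtain a c where a: "\<And>z. \<phi> z = a \<bullet> z + c"
    using assms unfolding affine_map_def by auto
  have \<phi>: "\<phi> = (\<lambda>z. a \<bullet> z + c)"
    using a by auto
  have der: "GDERIV \<phi> z :> a"
    unfolding gderiv_def \<phi> by (auto intro!: derivative_eq_intros simp: inner_commute)
  have "GDERIV \<phi> z :> grad \<phi> z"
    using gderiv_grad[OF der] .
  with der have "(\<lambda>h. h \<bullet> grad \<phi> z) = (\<lambda>h. h \<bullet> a)"
    unfolding gderiv_def using has_derivative_unique by blast
  then have "grad \<phi> z = a"
    by (metis inner_commute vector_eq_rdot)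
  then show ?thesis
    by (simp add: a inner_diff_right)
qed


section \<open>Farkas' lemma, projections and weighted minimizers\<close>

text \<open>
  Induction on the family: if a direction \<open>d\<^sub>0\<close> refutes the implication without the constraint \<open>k\<close>,
  projecting along \<open>d\<^sub>0\<close> onto the hyperplane \<open>a k \<bullet> d = 0\<close> eliminates that constraint.
\<close>

lemma farkas:
  fixes a :: "'i \<Rightarrow> 'a::real_inner"
  assumes "finite I" and "\<And>d. (\<forall>i\<in>I. a i \<bullet> d \<le> 0) \<Longrightarrow> v \<bullet> d \<le> 0"
  shows "\<exists>c. (\<forall>i\<in>I. c i \<ge> 0) \<and> v = (\<Sum>i\<in>I. c i *\<^sub>R a i)"
  using assms
proof (induction I arbitrary: a v rule: finite_induct)
  case empty
  then have "v \<bullet> v \<le> 0" by simp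
  then have "v = 0" by (metis inner_ge_zero inner_eq_zero_iff order_antisym)
  then show ?case by simp
next
  case (insert k I)
  show ?case
  proof (cases "\<forall>d. (\<forall>i\<in>I. a i \<bullet> d \<le> 0) \<longrightarrow> v \<bullet> d \<le> 0")
    case True
    then obtain c where "\<forall>i\<in>I. c i \<ge> 0" "v = (\<Sum>i\<in>I. c i *\<^sub>R a i)"
      using insert.IH[of a v] by blast
    then show ?thesis
      using insert.hyps by (intro exI[of _ "c(k := 0)"]) (auto intro!: sum.cong)
  next
    case False
    then obtain d1 where d1: "\<forall>i\<in>I. a i \<bullet> d1 \<le> 0" "v \<bullet> d1 > 0"
      by (auto simp: not_le)
    \<comment> \<open>\<open>d1\<close> respects every constraint in \<open>I\<close> but refutes
      the conclusion, so it must violate constraint \<open>k\<close>.\<close>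
    with insert.prems[of d1] have k1: "a k \<bullet> d1 > 0"
      by force
    define d0 where "d0 = (1 / (a k \<bullet> d1)) *\<^sub>R d1"
    have d0: "a k \<bullet> d0 = 1" "\<And>i. i \<in> I \<Longrightarrow> a i \<bullet> d0 \<le> 0" "v \<bullet> d0 > 0"
      using d1 k1 by (auto simp: d0_def divide_simps)
    define a' where "a' i = a i - (a i \<bullet> d0) *\<^sub>R a k" for i
    define v' where "v' = v - (v \<bullet> d0) *\<^sub>R a k"
    have "v' \<bullet> d \<le> 0" if "\<forall>i\<in>I. a' i \<bullet> d \<le> 0" for d
    proof -
      let ?d = "d - (a k \<bullet> d) *\<^sub>R d0"
      have "\<forall>i\<in>insert k I. a i \<bullet> ?d \<le> 0"
        using that d0(1) by (auto simp: a'_def inner_diff_left inner_diff_right algebra_simps)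
      from insert.prems[OF this] show ?thesis
        by (simp add: v'_def inner_diff_left inner_diff_right algebra_simps)
    qed
    then obtain c where c: "\<forall>i\<in>I. c i \<ge> 0" "v' = (\<Sum>i\<in>I. c i *\<^sub>R a' i)"
      using insert.IH[of a' v'] by blast
    \<comment> \<open>Expanding each \<open>a' i\<close> leaves \<open>r\<close> as the coefficient
      of \<open>a k\<close>. It is nonnegative because \<open>v \<bullet> d0 > 0\<close> while
      \<open>a i \<bullet> d0 \<le> 0\<close> on \<open>I\<close>.\<close>
    define r where "r = v \<bullet> d0 - (\<Sum>i\<in>I. c i * (a i \<bullet> d0))"
    have "(\<Sum>i\<in>I. c i * (a i \<bullet> d0)) \<le> 0"
      using c(1) d0(2) by (intro sum_nonpos) (auto intro: mult_nonneg_nonpos)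
    then have "r \<ge> 0"
      using d0(3) by (simp add: r_def)
    moreover have "v = r *\<^sub>R a k + (\<Sum>i\<in>I. c i *\<^sub>R a i)"
      using c(2) by (simp add: v'_def a'_def r_def sum_subtractf scaleR_diff_right
          scaleR_diff_left scaleR_sum_left algebra_simps)
    moreover have "(\<Sum>i\<in>I. (c(k := r)) i *\<^sub>R a i) = (\<Sum>i\<in>I. c i *\<^sub>R a i)"
      using insert.hyps by (intro sum.cong) auto
    ultimately show ?thesis
      using insert.hyps c(1) by (intro exI[of _ "c(k := r)"]) auto
  qed
qed

text \<open>Since \<open>C\<close> may fail to be closed, the projection inequality for closed
  convex sets is applied to the segment from \<open>p\<close> to \<open>c\<close>, which lies in
  \<open>C\<close>.\<close>

lemma closest_point_obtuse:
  fixes p y :: "'a::euclidean_space"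
  assumes C: "convex C" and p: "p \<in> C" and c: "c \<in> C"
    and min: "\<And>q. q \<in> C \<Longrightarrow> norm (p - y) \<le> norm (q - y)"
  shows "(y - p) \<bullet> (c - p) \<le> 0"
proof (rule any_closest_point_dot)
  show "\<forall>z\<in>closed_segment p c. dist y p \<le> dist y z"
    using closed_segment_subset[OF p c C] min by (auto simp: dist_norm norm_minus_commute)
qed auto

text \<open>
  For the closest point \<open>p\<close> of \<open>C\<close> inside the ball around \<open>b\<close> through \<open>y\<close>, the angle at \<open>p\<close> between
  \<open>y\<close> and \<open>b\<close> is obtuse; hence \<open>p\<close> lies strictly inside the ball and the ball may be dropped.
\<close>

lemma closest_point_in_ball_obtuse:
  fixes p y :: "'a::euclidean_space"
  assumes C: "convex C" and p: "p \<in> C" and c: "c \<in> C" and b: "b \<in> C" and "p \<noteq> y"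
    and ball: "norm (b - p) \<le> norm (b - y)"
    and min: "\<And>q. q \<in> C \<Longrightarrow> norm (b - q) \<le> norm (b - y) \<Longrightarrow> norm (p - y) \<le> norm (q - y)"
  shows "(y - p) \<bullet> (c - p) \<le> 0"
proof -
  define D where "D = C \<inter> cball b (norm (b - y))"
  have obt: "(y - p) \<bullet> (q - p) \<le> 0" if "q \<in> D" for q
    using that C p ball min
    by (intro closest_point_obtuse[of D]) (auto simp: D_def dist_norm intro: convex_Int)
  \<comment> \<open>Law of cosines at \<open>p\<close>: \<open>b\<close> itself lies in
    \<open>D\<close>, which fixes the sign of the mixed term, and \<open>p \<noteq> y\<close> makes
    the resulting inequality strict.\<close>
  have "(norm (b - y))\<^sup>2 = (norm ((b - p) - (y - p)))\<^sup>2"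
    by simp
  also have "\<dots> = (norm (b - p))\<^sup>2 + (norm (y - p))\<^sup>2 - 2 * ((y - p) \<bullet> (b - p))"
    by (simp add: power2_norm_eq_inner inner_diff_left inner_diff_right inner_commute)
  finally have "(norm (b - p))\<^sup>2 < (norm (b - y))\<^sup>2"
    using obt[of b] b \<open>p \<noteq> y\<close> by (auto simp: D_def)
      (smt (verit, ccfv_SIG) right_minus_eq zero_less_norm_iff zero_less_power)
  then have int: "norm (b - p) < norm (b - y)"
    by (rule power_less_imp_less_base) simp
  \<comment> \<open>A short step from \<open>p\<close> towards \<open>c\<close> stays in the ball,
    hence in \<open>D\<close>; its inequality is \<open>t\<close> times the one wanted.\<close>
  have "((\<lambda>t. norm (b - (p + t *\<^sub>R (c - p)))) \<longlongrightarrow> norm (b - (p + 0 *\<^sub>R (c - p)))) (at_right 0)"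
    by (intro tendsto_intros)
  then have "eventually (\<lambda>t. norm (b - (p + t *\<^sub>R (c - p))) < norm (b - y)) (at_right 0)"
    using int by (intro order_tendstoD(2)[where y = "norm (b - (p + 0 *\<^sub>R (c - p)))"]) auto
  moreover have "eventually (\<lambda>t::real. t \<in> {0<..<1}) (at_right 0)"
    by (rule eventually_at_rightI[of 0 1]) auto
  ultimately have "eventually (\<lambda>t. (y - p) \<bullet> (c - p) \<le> 0) (at_right (0::real))"
  proof eventually_elim
    case (elim t)
    have "(1 - t) *\<^sub>R p + t *\<^sub>R c \<in> C"
      using elim C p c by (intro convexD) auto
    moreover have "(1 - t) *\<^sub>R p + t *\<^sub>R c = p + t *\<^sub>R (c - p)"
      by (simp add: algebra_simps)
    ultimately have "p + t *\<^sub>R (c - p) \<in> D"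
      using elim by (auto simp: D_def dist_norm)
    from obt[OF this] show ?case
      using elim by (simp add: mult_le_0_iff)
  qed
  then show ?thesis
    by simp
qed

text \<open>The objective vanishes at \<open>d\<close> and is positive elsewhere, so the choice made
  by \<open>arg_min\<close> has a single candidate.\<close>

lemma arg_min_wnorm2_self:
  assumes W: "sym_pos_def W" and d: "Q d"
  shows "arg_min (\<lambda>v. 1/2 * wnorm2 W (v - d)) Q = d"
proof -
  let ?f = "\<lambda>v. 1/2 * wnorm2 W (v - d)"
  have pos: "?f v > 0" if "v \<noteq> d" for v
    using W that by (simp add: sym_pos_def_def wnorm2_def)
  have z: "?f d = 0"
    by (simp add: wnorm2_def)
  have "is_arg_min ?f Q d"
    unfolding is_arg_min_def
  proof (intro conjI notI d)
    assume "\<exists>v. Q v \<and> ?f v < ?f d"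
    then obtain v where v: "?f v < ?f d" by blast
    with pos[of v] z show False by (cases "v = d") auto
  qed
  then have "is_arg_min ?f Q (arg_min ?f Q)"
    unfolding arg_min_def by (rule someI)
  then have "\<not> ?f d < ?f (arg_min ?f Q)"
    using d unfolding is_arg_min_def by blast
  with z pos[of "arg_min ?f Q"] show ?thesis
    by (cases "arg_min ?f Q = d") auto
qed

text \<open>\<open>F\<close> holds the normals of the half-spaces tight at \<open>x\<close>. At a
  point of \<open>X\<close> the other half-spaces hold strictly and survive short steps, so these
  finitely many normals decide which directions are feasible; they are the form in which
  \<open>X\<close> enters Farkas' lemma.\<close>

lemma polyhedron_eventually_in:
  assumes X: "polyhedron X"
  obtains F where "finite F" and "\<And>q x'. q \<in> F \<Longrightarrow> x' \<in> X \<Longrightarrow> q \<bullet> (x' - x) \<le> 0"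
    and "\<And>d. (\<forall>q\<in>F. q \<bullet> d \<le> 0) \<Longrightarrow> x \<in> X \<Longrightarrow> eventually (\<lambda>t. x + t *\<^sub>R d \<in> X) (at_right 0)"
proof -
  obtain H where H: "finite H" "X = \<Inter> H" "\<forall>h\<in>H. \<exists>a b. a \<noteq> 0 \<and> h = {x. a \<bullet> x \<le> b}"
    using X unfolding polyhedron_def by auto
  then obtain a b where "\<And>h. h \<in> H \<Longrightarrow> h = {x. a h \<bullet> x \<le> (b h :: real)}"
    by metis
  then have ab: "u \<in> h \<longleftrightarrow> a h \<bullet> u \<le> b h" if "h \<in> H" for h u
    using that by blast
  define F where "F = a ` {h\<in>H. a h \<bullet> x = b h}"
  show thesis
  proof
    show "finite F"
      using H(1) by (simp add: F_def)
    show "q \<bullet> (x' - x) \<le> 0" if "q \<in> F" "x' \<in> X" for q x'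
      using that ab H(2) unfolding F_def by (fastforce simp: inner_diff_right)
    show "eventually (\<lambda>t. x + t *\<^sub>R d \<in> X) (at_right 0)"
      if d: "\<forall>q\<in>F. q \<bullet> d \<le> 0" and x: "x \<in> X" for d
    proof -
      have "eventually (\<lambda>t. x + t *\<^sub>R d \<in> h) (at_right 0)" if h: "h \<in> H" for h
      proof (cases "a h \<bullet> x = b h")
        case True
        then have "a h \<bullet> d \<le> 0"
          using d h by (auto simp: F_def)
        have "eventually (\<lambda>t::real. t > 0) (at_right 0)"
          by (simp add: eventually_at_right_less)
        then show ?thesis
        proof eventually_elim
          case (elim t)
          then have "a h \<bullet> (x + t *\<^sub>R d) \<le> b h"
            using True \<open>a h \<bullet> d \<le> 0\<close> by (simp add: inner_add_right mult_nonneg_nonpos)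
          then show ?case using ab[OF h] by blast
        qed
      next
        case False
        then have "a h \<bullet> x < b h"
          using x h H(2) ab[OF h] by force
        moreover have "((\<lambda>t. a h \<bullet> (x + t *\<^sub>R d)) \<longlongrightarrow> a h \<bullet> (x + 0 *\<^sub>R d)) (at_right 0)"
          by (intro tendsto_intros)
        ultimately have "eventually (\<lambda>t. a h \<bullet> (x + t *\<^sub>R d) < b h) (at_right 0)"
          by (intro order_tendstoD(2)[where y = "a h \<bullet> (x + 0 *\<^sub>R d)"]) auto
        then show ?thesis
        proof eventually_elim
          case (elim t)
          then show ?case using ab[OF h] by simp
        qed
      qed
      then have "eventually (\<lambda>t. \<forall>h\<in>H. x + t *\<^sub>R d \<in> h) (at_right 0)"
        using H(1) by (simp add: eventually_ball_finite)
      then show ?thesis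
        by (simp add: H(2))
    qed
  qed
qed


section \<open>Convex mixed-integer programs\<close>

lemma nlp_solution_J: "nlp_solution P y x \<Longrightarrow> J P y = ereal (obj P (x, y))"
  unfolding J_def nlp_solution_def is_arg_min_def
  by (intro INF_eqI) (auto simp: not_less)

lemma J_le: "nlp_feasible P y x \<Longrightarrow> J P y \<le> ereal (obj P (x, y))"
  unfolding J_def by (auto intro: INF_lower2)

locale convex_minlp =
  fixes P :: "('nx::finite, 'ny::finite) minlp"
    and A :: "('nx, 'ny) params"
  assumes polyX: "polyhedron (Xset P)" and polyY: "polyhedron (Yrel P)"
    and finY: "finite (Yint P)"
    and C2_obj: "C2 (obj P)"
    and C2_ineq: "\<And>i. i < n_ineq P \<Longrightarrow> C2 (ineq P i)"
    and mfcq: "\<And>y x. y \<in> Yint P \<Longrightarrow> nlp_solution P y x \<Longrightarrow> mfcq P y x"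
    and affine: "\<And>j. j < n_eq P \<Longrightarrow> affine_map (eqc P j)"
    and cvx_ineq: "\<And>i. i < n_ineq P \<Longrightarrow> convex_on (Xset P \<times> Yrel P) (ineq P i)"
    and cvx_obj: "convex_on (Xset P \<times> Yrel P) (obj P)"
    and W: "sym_pos_def (weight A)"
    and alph: "0 \<le> alph A" "alph A < 1"
begin

lemma Yint_subset: "Yint P \<subseteq> Yrel P"
  by (auto simp: Yint_def)

lemma lin_obj_le:
  "z \<in> Xset P \<times> Yrel P \<Longrightarrow> z' \<in> Xset P \<times> Yrel P \<Longrightarrow> lin (obj P) z z' \<le> obj P z'"
  unfolding lin_def by (rule convex_above_gradient[OF cvx_obj C2_gderiv[OF C2_obj]])

lemma lin_ineq_le:
  "i < n_ineq P \<Longrightarrow> z \<in> Xset P \<times> Yrel P \<Longrightarrow> z' \<in> Xset P \<times> Yrel P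
    \<Longrightarrow> lin (ineq P i) z z' \<le> ineq P i z'"
  unfolding lin_def by (rule convex_above_gradient[OF cvx_ineq C2_gderiv[OF C2_ineq]])

lemma lin_eqc: "j < n_eq P \<Longrightarrow> lin (eqc P j) z z' = eqc P j z'"
  unfolding lin_def using affine_map_grad[OF affine] by metis

section \<open>Cuts generated by KKT points\<close>

lemma inner_grad_lagrangian:
  "grad_lagrangian P lam mu z \<bullet> w = grad (obj P) z \<bullet> w
     + (\<Sum>i<n_ineq P. lam i * (grad (ineq P i) z \<bullet> w))
     + (\<Sum>j<n_eq P. mu j * (grad (eqc P j) z \<bullet> w))"
  by (simp add: grad_lagrangian_def inner_add_left inner_sum_left)

text \<open>Pair the gradient of the Lagrangian with the displacement: its \<open>x\<close>-part
  contributes a nonnegative amount by normality to \<open>X\<close>, its \<open>y\<close>-part is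
  \<open>- muy\<close>, and the constraint terms are nonpositive or zero. Asking only for the
  linearized constraints lets the bound serve both the Benders cuts and LB-MILP.\<close>

lemma kkt_lin_obj_ge:
  assumes kkt: "kkt P x y lam mu muy" and x': "x' \<in> Xset P"
    and ineq: "\<And>i. i < n_ineq P \<Longrightarrow> lin (ineq P i) (x, y) (x', y') \<le> 0"
    and eq: "\<And>j. j < n_eq P \<Longrightarrow> lin (eqc P j) (x, y) (x', y') = 0"
  shows "obj P (x, y) + (- muy) \<bullet> (y' - y) \<le> lin (obj P) (x, y) (x', y')"
proof -
  let ?w = "(x', y') - (x, y)"
  have "grad_lagrangian P lam mu (x, y) \<bullet> ?w
      = fst (grad_lagrangian P lam mu (x, y)) \<bullet> (x' - x) + (- muy) \<bullet> (y' - y)"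
    using kkt by (simp add: kkt_def inner_prod_def)
  moreover have "fst (grad_lagrangian P lam mu (x, y)) \<bullet> (x' - x) \<ge> 0"
    using kkt x' by (simp add: kkt_def)
  ultimately have "(- muy) \<bullet> (y' - y) \<le> grad_lagrangian P lam mu (x, y) \<bullet> ?w"
    by simp
  moreover have "lam i * (grad (ineq P i) (x, y) \<bullet> ?w) \<le> 0" if "i < n_ineq P" for i
  proof -
    have "lam i \<ge> 0" "lam i * ineq P i (x, y) = 0"
      using kkt that by (auto simp: kkt_def)
    \<comment> \<open>Multiplied by \<open>lam i\<close>, the linearized constraint loses its
      constant term by complementarity.\<close>
    then show ?thesis
      using mult_left_mono[OF ineq[OF that] \<open>lam i \<ge> 0\<close>] by (auto simp: lin_def distrib_left)
  qed
  then have "(\<Sum>i<n_ineq P. lam i * (grad (ineq P i) (x, y) \<bullet> ?w)) \<le> 0"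
    by (intro sum_nonpos) auto
  moreover have "mu j * (grad (eqc P j) (x, y) \<bullet> ?w) = 0" if "j < n_eq P" for j
    using eq[OF that] kkt that by (simp add: lin_def kkt_def nlp_feasible_def constr_def)
  then have "(\<Sum>j<n_eq P. mu j * (grad (eqc P j) (x, y) \<bullet> ?w)) = 0"
    by (intro sum.neutral) auto
  ultimately show ?thesis
    by (simp add: inner_grad_lagrangian lin_def)
qed

text \<open>Linearizations of convex functions underestimate, so a feasible point satisfies the
  linearized constraints and has at least the linearized objective.\<close>

lemma kkt_gradient_cut:
  assumes kkt: "kkt P x y lam mu muy" and y: "y \<in> Yrel P"
    and z: "x' \<in> Xset P" "y' \<in> Yrel P" "constr P (x', y')"
  shows "obj P (x, y) + (- muy) \<bullet> (y' - y) \<le> obj P (x', y')"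
proof -
  have x: "x \<in> Xset P"
    using kkt by (simp add: kkt_def nlp_feasible_def)
  have "lin (ineq P i) (x, y) (x', y') \<le> 0" if "i < n_ineq P" for i
    using lin_ineq_le[OF that, of "(x, y)" "(x', y')"] z x y that by (force simp: constr_def)
  moreover have "lin (eqc P j) (x, y) (x', y') = 0" if "j < n_eq P" for j
    using z(3) that by (simp add: lin_eqc constr_def)
  ultimately have "obj P (x, y) + (- muy) \<bullet> (y' - y) \<le> lin (obj P) (x, y) (x', y')"
    using z by (intro kkt_lin_obj_ge[OF kkt]) auto
  also have "\<dots> \<le> obj P (x', y')"
    using x y z by (intro lin_obj_le) auto
  finally show ?thesis .
qed

section \<open>Existence of multipliers\<close>

text \<open>Otherwise a short step along \<open>d\<close> would be feasible with a smaller
  objective: active inequalities decrease, inactive ones stay negative, and equalities persist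
  exactly because they are affine.\<close>

lemma nlp_solution_no_descent:
  assumes sol: "nlp_solution P y x"
    and ev: "eventually (\<lambda>t. x + t *\<^sub>R d \<in> Xset P) (at_right 0)"
    and eq: "\<And>j. j < n_eq P \<Longrightarrow> fst (grad (eqc P j) (x, y)) \<bullet> d = 0"
    and act: "\<And>i. i < n_ineq P \<Longrightarrow> ineq P i (x, y) = 0 \<Longrightarrow> fst (grad (ineq P i) (x, y)) \<bullet> d < 0"
  shows "fst (grad (obj P) (x, y)) \<bullet> d \<ge> 0"
proof (rule ccontr)
  assume "\<not> fst (grad (obj P) (x, y)) \<bullet> d \<ge> 0"
  then have neg: "grad (obj P) (x, y) \<bullet> (d, 0) < 0"
    by (simp add: inner_prod_def)
  have line: "(x, y) + t *\<^sub>R (d, 0) = (x + t *\<^sub>R d, y)" for t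
    by simp
  have feas: "nlp_feasible P y x"
    using sol by (simp add: nlp_solution_def is_arg_min_def)
  have "eventually (\<lambda>t. obj P ((x, y) + t *\<^sub>R (d, 0)) < obj P (x, y)) (at_right 0)"
    by (rule gderiv_eventually_less[OF C2_gderiv[OF C2_obj] neg])
  moreover have "eventually (\<lambda>t. \<forall>i\<in>{..<n_ineq P}. ineq P i ((x, y) + t *\<^sub>R (d, 0)) \<le> 0) (at_right 0)"
  proof (intro eventually_ball_finite ballI)
    fix i assume "i \<in> {..<n_ineq P}"
    then have i: "i < n_ineq P" by simp
    have "eventually (\<lambda>t. ineq P i ((x, y) + t *\<^sub>R (d, 0)) < 0) (at_right 0)"
    proof (cases "ineq P i (x, y) = 0")
      case True
      then have "grad (ineq P i) (x, y) \<bullet> (d, 0) < 0"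
        using act[OF i] by (simp add: inner_prod_def)
      from gderiv_eventually_less[OF C2_gderiv[OF C2_ineq[OF i]] this] show ?thesis
        by (simp only: True)
    next
      case False
      then have "ineq P i (x, y) < 0"
        using feas i by (force simp: nlp_feasible_def constr_def)
      from gderiv_eventually_neg[OF C2_gderiv[OF C2_ineq[OF i]] this] show ?thesis .
    qed
    then show "eventually (\<lambda>t. ineq P i ((x, y) + t *\<^sub>R (d, 0)) \<le> 0) (at_right 0)"
      by (rule eventually_mono) simp
  qed simp
  ultimately have "eventually (\<lambda>t. nlp_feasible P y (x + t *\<^sub>R d)
      \<and> obj P (x + t *\<^sub>R d, y) < obj P (x, y)) (at_right 0)"
    using ev
  proof eventually_elim
    case (elim t)
    have "eqc P j (x + t *\<^sub>R d, y) = 0" if j: "j < n_eq P" for j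
    proof -
      have "eqc P j (x + t *\<^sub>R d, y) = eqc P j (x, y) + t * (fst (grad (eqc P j) (x, y)) \<bullet> d)"
        using affine_map_grad[OF affine[OF j], of "(x + t *\<^sub>R d, y)" "(x, y)"]
        by (simp add: inner_prod_def)
      also have "\<dots> = 0"
        using eq[OF j] feas j by (simp add: nlp_feasible_def constr_def)
      finally show ?thesis .
    qed
    with elim show ?case
      by (auto simp: nlp_feasible_def constr_def line)
  qed
  then obtain t where "nlp_feasible P y (x + t *\<^sub>R d)" "obj P (x + t *\<^sub>R d, y) < obj P (x, y)"
    using eventually_happens'[OF trivial_limit_at_right_real] by blast
  then show False
    using sol by (auto simp: nlp_solution_def is_arg_min_def)
qed

lemma kkt_exists:
  assumes y: "y \<in> Yint P" and sol: "nlp_solution P y x"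
  shows "\<exists>lam mu muy. kkt P x y lam mu muy"
proof -
  define gf where "gf = fst (grad (obj P) (x, y))"
  define gi where "gi i = fst (grad (ineq P i) (x, y))" for i
  define hj where "hj j = fst (grad (eqc P j) (x, y))" for j
  define Act where "Act = {i. i < n_ineq P \<and> ineq P i (x, y) = 0}"
  have feas: "nlp_feasible P y x" and x: "x \<in> Xset P"
    using sol by (auto simp: nlp_solution_def is_arg_min_def nlp_feasible_def)
  obtain F where F: "finite F" "\<And>q x'. q \<in> F \<Longrightarrow> x' \<in> Xset P \<Longrightarrow> q \<bullet> (x' - x) \<le> 0"
    and ev: "\<And>d. (\<forall>q\<in>F. q \<bullet> d \<le> 0) \<Longrightarrow> x \<in> Xset P
               \<Longrightarrow> eventually (\<lambda>t. x + t *\<^sub>R d \<in> Xset P) (at_right 0)"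
    using polyhedron_eventually_in[OF polyX, of x] by metis
  obtain d0 t0 where d0: "t0 > 0" "x + t0 *\<^sub>R d0 \<in> Xset P"
      "\<And>j. j < n_eq P \<Longrightarrow> hj j \<bullet> d0 = 0" "\<And>i. i \<in> Act \<Longrightarrow> gi i \<bullet> d0 < 0"
    using mfcq[OF y sol] unfolding mfcq_def hj_def gi_def Act_def by auto
  \<comment> \<open>The constraint qualification offers one point of \<open>X\<close> along
    \<open>d0\<close>; each normal in \<open>F\<close> bounds that displacement, and dividing by
    \<open>t0 > 0\<close> bounds \<open>d0\<close>.\<close>
  have Fd0: "q \<bullet> d0 \<le> 0" if "q \<in> F" for q
    using F(2)[OF that d0(2)] d0(1) by (simp add: mult_le_0_iff)
  have descent: "gf \<bullet> d \<ge> 0"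
    if d: "\<forall>q\<in>F. q \<bullet> d \<le> 0" "\<And>j. j < n_eq P \<Longrightarrow> hj j \<bullet> d = 0" "\<And>i. i \<in> Act \<Longrightarrow> gi i \<bullet> d \<le> 0" for d
  proof -
    \<comment> \<open>Farkas' lemma has to be fed with weak inequalities. Adding a small multiple of
      \<open>d0\<close> to \<open>d\<close> makes the active ones strict, and the sign of the slope
      survives the limit.\<close>
    have "((\<lambda>e. gf \<bullet> (d + e *\<^sub>R d0)) \<longlongrightarrow> gf \<bullet> (d + 0 *\<^sub>R d0)) (at_right 0)"
      by (intro tendsto_intros)
    moreover have "eventually (\<lambda>e. gf \<bullet> (d + e *\<^sub>R d0) \<ge> 0) (at_right 0)"
    proof (rule eventually_at_rightI)
      fix e :: real assume e: "e \<in> {0<..<1}"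
      show "gf \<bullet> (d + e *\<^sub>R d0) \<ge> 0"
        unfolding gf_def
      proof (rule nlp_solution_no_descent[OF sol ev])
        show "\<forall>q\<in>F. q \<bullet> (d + e *\<^sub>R d0) \<le> 0"
          using d(1) Fd0 e by (auto simp: inner_add_right intro!: add_nonpos_nonpos mult_nonneg_nonpos)
        show "fst (grad (eqc P j) (x, y)) \<bullet> (d + e *\<^sub>R d0) = 0" if "j < n_eq P" for j
          using d(2)[OF that] d0(3)[OF that] by (simp add: inner_add_right hj_def)
        show "fst (grad (ineq P i) (x, y)) \<bullet> (d + e *\<^sub>R d0) < 0"
          if "i < n_ineq P" "ineq P i (x, y) = 0" for i
        proof -
          have "i \<in> Act" using that by (simp add: Act_def)
          then have "gi i \<bullet> d + e * (gi i \<bullet> d0) < 0"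
            using d(3) d0(4) e by (intro add_nonpos_neg mult_pos_neg) auto
          then show ?thesis by (simp add: inner_add_right gi_def)
        qed
      qed (fact x)
    qed simp
    ultimately have "gf \<bullet> (d + 0 *\<^sub>R d0) \<ge> 0"
      by (rule tendsto_lowerbound) simp
    then show ?thesis by simp
  qed
  \<comment> \<open>Each equality enters with both signs, so that its multiplier is a difference of
    two nonnegative weights.\<close>
  let ?I = "F <+> (Act <+> ({..<n_eq P} <+> {..<n_eq P}))"
  let ?a = "case_sum (\<lambda>q. q) (case_sum gi (case_sum hj (\<lambda>j. - hj j)))"
  have fin: "finite Act"
    by (simp add: Act_def)
  have "(- gf) \<bullet> d \<le> 0" if d: "\<forall>i\<in>?I. ?a i \<bullet> d \<le> 0" for d
  proof -
    have "hj j \<bullet> d = 0" if "j < n_eq P" for j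
    proof (rule antisym)
      show "hj j \<bullet> d \<le> 0"
        using d[rule_format, of "Inr (Inr (Inl j))"] that by auto
      show "0 \<le> hj j \<bullet> d"
        using d[rule_format, of "Inr (Inr (Inr j))"] that by auto
    qed
    moreover have "\<forall>q\<in>F. q \<bullet> d \<le> 0" "\<And>i. i \<in> Act \<Longrightarrow> gi i \<bullet> d \<le> 0"
      using d[rule_format, of "Inl _"] d[rule_format, of "Inr (Inl _)"] by auto
    ultimately show ?thesis
      using descent by simp
  qed
  then obtain c where c: "\<forall>i\<in>?I. c i \<ge> 0" "- gf = (\<Sum>i\<in>?I. c i *\<^sub>R ?a i)"
    using farkas[of ?I ?a "- gf"] F(1) fin by auto
  \<comment> \<open>Zero weight off the active set provides complementarity.\<close>
  define lam where "lam i = (if i \<in> Act then c (Inr (Inl i)) else 0)" for i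
  define mu where "mu j = c (Inr (Inr (Inl j))) - c (Inr (Inr (Inr j)))" for j
  have "(\<Sum>i<n_ineq P. lam i *\<^sub>R gi i) = (\<Sum>i\<in>Act. c (Inr (Inl i)) *\<^sub>R gi i)"
    by (rule sum.mono_neutral_cong_right) (auto simp: Act_def lam_def)
  then have lagr: "fst (grad_lagrangian P lam mu (x, y)) = - (\<Sum>q\<in>F. c (Inl q) *\<^sub>R q)"
    using c(2) F(1) fin
    by (simp add: grad_lagrangian_def sum.Plus fst_sum gf_def[symmetric] gi_def[symmetric]
        hj_def[symmetric] mu_def scaleR_diff_left sum_subtractf sum_negf o_def)
      (simp add: algebra_simps eq_neg_iff_add_eq_0)
  have "fst (grad_lagrangian P lam mu (x, y)) \<bullet> (x' - x) \<ge> 0" if "x' \<in> Xset P" for x'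
  proof -
    have "(\<Sum>q\<in>F. c (Inl q) * (q \<bullet> (x' - x))) \<le> 0"
      using c(1) F(2) that by (intro sum_nonpos mult_nonneg_nonpos) auto
    then show ?thesis
      by (simp add: lagr inner_sum_left)
  qed
  moreover have "lam i \<ge> 0 \<and> lam i * ineq P i (x, y) = 0" for i
    using c(1) by (auto simp: lam_def Act_def)
  \<comment> \<open>The multiplier of the constraint fixing \<open>y\<close> has no sign condition,
    so stationarity in \<open>y\<close> simply defines it.\<close>
  ultimately have "kkt P x y lam mu (- snd (grad_lagrangian P lam mu (x, y)))"
    using feas by (auto simp: kkt_def)
  then show ?thesis by blast
qed

section \<open>Projection in the feasibility problem\<close>

definition relaxed_feasible :: "(real^'ny) set" where
  "relaxed_feasible = {y \<in> Yrel P. \<exists>x. nlp_feasible P y x}"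

lemma convex_relaxed_feasible: "convex relaxed_feasible"
  unfolding convex_alt
proof (intro ballI allI impI)
  fix y1 y2 and u :: real
  assume "y1 \<in> relaxed_feasible" "y2 \<in> relaxed_feasible" and u: "0 \<le> u \<and> u \<le> 1"
  then obtain x1 x2 where y: "y1 \<in> Yrel P" "y2 \<in> Yrel P"
    and x: "nlp_feasible P y1 x1" "nlp_feasible P y2 x2"
    by (auto simp: relaxed_feasible_def)
  have X: "x1 \<in> Xset P" "x2 \<in> Xset P"
    using x by (auto simp: nlp_feasible_def)
  let ?x = "(1 - u) *\<^sub>R x1 + u *\<^sub>R x2" and ?y = "(1 - u) *\<^sub>R y1 + u *\<^sub>R y2"
  have pair: "(?x, ?y) = (1 - u) *\<^sub>R (x1, y1) + u *\<^sub>R (x2, y2)"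
    by simp
  have "?y \<in> Yrel P" "?x \<in> Xset P"
    using y X u polyhedron_imp_convex[OF polyX] polyhedron_imp_convex[OF polyY]
    by (auto simp: convex_alt)
  moreover have "ineq P i (?x, ?y) \<le> 0" if i: "i < n_ineq P" for i
  proof -
    have "ineq P i (?x, ?y) \<le> (1 - u) * ineq P i (x1, y1) + u * ineq P i (x2, y2)"
      unfolding pair using u X y by (intro convex_onD[OF cvx_ineq[OF i]]) auto
    also have "\<dots> \<le> 0"
      using x i u by (intro add_nonpos_nonpos mult_nonneg_nonpos)
        (auto simp: nlp_feasible_def constr_def)
    finally show ?thesis .
  qed
  moreover have "eqc P j (?x, ?y) = 0" if j: "j < n_eq P" for j
  proof -
    obtain a c where a: "\<And>z. eqc P j z = a \<bullet> z + c"
      using affine[OF j] unfolding affine_map_def by auto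
    have "eqc P j (?x, ?y) = (1 - u) * eqc P j (x1, y1) + u * eqc P j (x2, y2)"
      unfolding pair a inner_add_right inner_scaleR_right by (simp add: algebra_simps)
    also have "\<dots> = 0"
      using x j by (simp add: nlp_feasible_def constr_def)
    finally show ?thesis .
  qed
  ultimately show "?y \<in> relaxed_feasible"
    by (auto simp: relaxed_feasible_def nlp_feasible_def constr_def)
qed

lemma relaxed_feasible_iff:
  "y \<in> relaxed_feasible \<longleftrightarrow> (\<exists>x\<in>Xset P. y \<in> Yrel P \<and> constr P (x, y))"
  by (auto simp: relaxed_feasible_def nlp_feasible_def)

text \<open>\<open>p\<close> is a closest point of \<open>relaxed_feasible\<close> to the current
  iterate, confined to a ball around the best point once one is known. The two projection
  inequalities cover the two cases. \<open>p\<close> differs from the iterate because only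
  \<open>p\<close> admits a feasible \<open>x\<close>.\<close>

lemma fnlp_solution_cut:
  assumes sol: "fnlp_solution P s (x, p)" and infeas: "\<nexists>x. nlp_feasible P (ys s (iter s)) x"
    and best: "Ts s \<noteq> {} \<Longrightarrow> ys s (best s) \<in> relaxed_feasible"
  shows "ys s (iter s) \<noteq> p"
    and "c \<in> relaxed_feasible \<Longrightarrow> (ys s (iter s) - p) \<bullet> (c - p) \<le> 0"
proof -
  let ?y = "ys s (iter s)" and ?b = "ys s (best s)"
  have feas: "fnlp_feasible P s (x, p)"
    and opt: "\<And>z. fnlp_feasible P s z \<Longrightarrow> norm (p - ?y) \<le> norm (snd z - ?y)"
    using sol by (auto simp: fnlp_solution_def is_arg_min_def not_less)
  have p: "p \<in> relaxed_feasible"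
    using feas by (auto simp: fnlp_feasible_def relaxed_feasible_iff)
  then show ne: "?y \<noteq> p"
    using infeas by (auto simp: relaxed_feasible_def)
  have opt': "norm (p - ?y) \<le> norm (q - ?y)"
    if q: "q \<in> relaxed_feasible" "Ts s \<noteq> {} \<Longrightarrow> norm (?b - q) \<le> norm (?b - ?y)" for q
  proof -
    obtain x' where "x' \<in> Xset P" "q \<in> Yrel P" "constr P (x', q)"
      using q(1) by (auto simp: relaxed_feasible_iff)
    then show ?thesis
      using opt[of "(x', q)"] q(2) by (auto simp: fnlp_feasible_def power_mono)
  qed
  assume c: "c \<in> relaxed_feasible"
  show "(?y - p) \<bullet> (c - p) \<le> 0"
  proof (cases "Ts s = {}")
    case True
    then show ?thesis
      using opt' by (intro closest_point_obtuse[OF convex_relaxed_feasible p c]) auto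
  next
    case False
    then have "norm (?b - p) \<le> norm (?b - ?y)"
      using feas by (auto simp: fnlp_feasible_def)
    then show ?thesis
      using opt' ne False best
      by (intro closest_point_in_ball_obtuse[OF convex_relaxed_feasible p c, of ?b]) auto
  qed
qed

end


section \<open>Runs of the algorithm\<close>

lemma atMost_insert: "insert n {..<n} = {..n::nat}"
  by auto

lemma best_index_in_Ts:
  assumes "finite (Ts s)" and "Ts s \<noteq> {}"
  shows "best_index P s \<in> Ts s"
    and "i \<in> Ts s \<Longrightarrow> J P (ys s (best_index P s)) \<le> J P (ys s i)"
proof -
  let ?min = "is_arg_min (\<lambda>i. J P (ys s i)) (\<lambda>i. i \<in> Ts s)"
  have "\<exists>i. ?min i"
    using ex_is_arg_min_if_finite[OF assms] by blast
  then have "?min (best_index P s)"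
    using assms(2) unfolding best_index_def by (auto intro: LeastI_ex)
  then show "best_index P s \<in> Ts s"
    and "i \<in> Ts s \<Longrightarrow> J P (ys s (best_index P s)) \<le> J P (ys s i)"
    by (auto simp: is_arg_min_def not_less)
qed

context convex_minlp
begin

section \<open>The loop invariant\<close>

text \<open>For \<open>Ss\<close> the cut inequality itself is recorded, as the feasibility problem
  solved earlier refers to a best point that may since have changed. The bound by the relaxation
  value keeps the feasibility problem solvable. Distinctness in phase \<open>Evaluate\<close> is
  tied to an open gap, because the last proposed point may be a repetition or arbitrary.\<close>

definition invar :: "('nx, 'ny) state \<Rightarrow> bool" where
  "invar s \<longleftrightarrow>
     Ts s \<union> Ss s = (if phase s = Evaluate then {..<iter s} else {..iter s}) \<and>
     (\<forall>i\<in>Ts s. ys s i \<in> Yint P \<and> nlp_solution P (ys s i) (xs s i) \<and>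
        (\<exists>lam mu. kkt P (xs s i) (ys s i) lam mu (- dJs s i))) \<and>
     (\<forall>i\<in>Ss s. ys s i \<noteq> ybars s i \<and>
        (\<forall>c\<in>relaxed_feasible. (ys s i - ybars s i) \<bullet> (c - ybars s i) \<le> 0)) \<and>
     (Ts s = {} \<longrightarrow> UB s = \<infinity>) \<and>
     (Ts s \<noteq> {} \<longrightarrow> best s \<in> Ts s \<and> (\<forall>i\<in>Ts s. J P (ys s (best s)) \<le> J P (ys s i)) \<and>
        UB s = J P (ys s (best s))) \<and>
     (INF y\<in>Yrel P. J P y) \<le> LB s \<and>
     (\<forall>z. minlp_feasible P z \<longrightarrow> LB s \<le> ereal (obj P z)) \<and>
     (phase s = Master \<or> LB s < UB s \<longrightarrow>
        inj_on (ys s) {..iter s} \<and> ys s ` {..iter s} \<subseteq> Yint P)"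

lemma invarI:
  assumes "Ts s \<union> Ss s = (if phase s = Evaluate then {..<iter s} else {..iter s})"
    and "\<And>i. i \<in> Ts s \<Longrightarrow> ys s i \<in> Yint P"
    and "\<And>i. i \<in> Ts s \<Longrightarrow> nlp_solution P (ys s i) (xs s i)"
    and "\<And>i. i \<in> Ts s \<Longrightarrow> \<exists>lam mu. kkt P (xs s i) (ys s i) lam mu (- dJs s i)"
    and "\<And>i. i \<in> Ss s \<Longrightarrow> ys s i \<noteq> ybars s i"
    and "\<And>i c. i \<in> Ss s \<Longrightarrow> c \<in> relaxed_feasible
        \<Longrightarrow> (ys s i - ybars s i) \<bullet> (c - ybars s i) \<le> 0"
    and "Ts s = {} \<Longrightarrow> UB s = \<infinity>"
    and "Ts s \<noteq> {} \<Longrightarrow> best s \<in> Ts s"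
    and "Ts s \<noteq> {} \<Longrightarrow> UB s = J P (ys s (best s))"
    and "\<And>i. i \<in> Ts s \<Longrightarrow> J P (ys s (best s)) \<le> J P (ys s i)"
    and "(INF y\<in>Yrel P. J P y) \<le> LB s"
    and "\<And>z. minlp_feasible P z \<Longrightarrow> LB s \<le> ereal (obj P z)"
    and "phase s = Master \<or> LB s < UB s
        \<Longrightarrow> inj_on (ys s) {..iter s} \<and> ys s ` {..iter s} \<subseteq> Yint P"
  shows "invar s"
  unfolding invar_def using assms by simp

lemma invarD:
  assumes "invar s"
  shows invar_index: "Ts s \<union> Ss s = (if phase s = Evaluate then {..<iter s} else {..iter s})"
    and invar_Ts_Yint: "i \<in> Ts s \<Longrightarrow> ys s i \<in> Yint P"
    and invar_Ts_solution: "i \<in> Ts s \<Longrightarrow> nlp_solution P (ys s i) (xs s i)"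
    and invar_Ts_kkt: "i \<in> Ts s \<Longrightarrow> \<exists>lam mu. kkt P (xs s i) (ys s i) lam mu (- dJs s i)"
    and invar_Ss_neq: "i \<in> Ss s \<Longrightarrow> ys s i \<noteq> ybars s i"
    and invar_Ss_cut: "i \<in> Ss s \<Longrightarrow> c \<in> relaxed_feasible
        \<Longrightarrow> (ys s i - ybars s i) \<bullet> (c - ybars s i) \<le> 0"
    and invar_UB_infinite: "Ts s = {} \<Longrightarrow> UB s = \<infinity>"
    and invar_best: "i \<in> Ts s \<Longrightarrow> best s \<in> Ts s" "i \<in> Ts s \<Longrightarrow> UB s = J P (ys s (best s))"
      "i \<in> Ts s \<Longrightarrow> J P (ys s (best s)) \<le> J P (ys s i)"
    and invar_LB_ge: "(INF y\<in>Yrel P. J P y) \<le> LB s"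
    and invar_LB_le: "minlp_feasible P z \<Longrightarrow> LB s \<le> ereal (obj P z)"
    and invar_distinct: "phase s = Master \<or> LB s < UB s
        \<Longrightarrow> inj_on (ys s) {..iter s} \<and> ys s ` {..iter s} \<subseteq> Yint P"
  using assms unfolding invar_def by blast+

lemma invar_J: "invar s \<Longrightarrow> i \<in> Ts s \<Longrightarrow> J P (ys s i) = ereal (obj P (xs s i, ys s i))"
  using nlp_solution_J invar_Ts_solution by blast

lemma invar_Ts_feasible:
  assumes "invar s" and "i \<in> Ts s"
  shows "xs s i \<in> Xset P" "ys s i \<in> Yint P" "constr P (xs s i, ys s i)"
    "ys s i \<in> relaxed_feasible"
proof -
  have 1: "ys s i \<in> Yint P" "nlp_feasible P (ys s i) (xs s i)"
    using invar_Ts_Yint[OF assms] invar_Ts_solution[OF assms]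
    by (auto simp: nlp_solution_def is_arg_min_def)
  then show "xs s i \<in> Xset P" "ys s i \<in> Yint P" "constr P (xs s i, ys s i)"
    by (auto simp: nlp_feasible_def)
  show "ys s i \<in> relaxed_feasible"
    using 1 Yint_subset by (auto simp: relaxed_feasible_def)
qed

section \<open>Validity of the cuts\<close>

lemma invar_cut_valid:
  assumes inv: "invar s" and i: "i \<in> Ts s" and z: "minlp_feasible P z"
  shows "J P (ys s i) + ereal (dJs s i \<bullet> (snd z - ys s i)) \<le> ereal (obj P z)"
proof -
  obtain lam mu where "kkt P (xs s i) (ys s i) lam mu (- dJs s i)"
    using invar_Ts_kkt[OF inv i] by blast
  from kkt_gradient_cut[OF this, of "fst z" "snd z"] show ?thesis
    using invar_Ts_feasible[OF inv i] z Yint_subset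
    by (auto simp: invar_J[OF inv i] minlp_feasible_def)
qed

text \<open>The best point is feasible for the MINLP and its objective is its
  \<open>J\<close>-value, so the valid cut evaluated there is the very test made by
  \<open>g_cut\<close>.\<close>

lemma invar_supports_best:
  assumes inv: "invar s" and i: "i \<in> Ts s"
  shows "supports_best P s i (dJs s i)"
proof -
  have b: "best s \<in> Ts s"
    using invar_best(1)[OF inv i] .
  have "minlp_feasible P (xs s (best s), ys s (best s))"
    using invar_Ts_feasible[OF inv b] by (simp add: minlp_feasible_def)
  from invar_cut_valid[OF inv i this] show ?thesis
    by (simp add: supports_best_def invar_J[OF inv b])
qed

lemma invar_g_cut: "invar s \<Longrightarrow> i \<in> Ts s \<Longrightarrow> g_cut P A s i = dJs s i"
  using invar_supports_best by (simp add: g_cut_def)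

text \<open>The best point lies in \<open>relaxed_feasible\<close>, so the original normal already
  meets the half-space condition and is its own projection.\<close>

lemma invar_n_cut:
  assumes inv: "invar s" and i: "i \<in> Ss s"
  shows "n_cut A s i = ys s i - ybars s i"
proof (cases "Ts s = {}")
  case False
  then have "best s \<in> Ts s"
    using invar_best(1)[OF inv] by blast
  then have "(ys s i - ybars s i) \<bullet> (ys s (best s) - ybars s i) \<le> 0"
    using invar_Ss_cut[OF inv i] invar_Ts_feasible(4)[OF inv] by blast
  then show ?thesis
    using False arg_min_wnorm2_self[OF W, of "\<lambda>n. n \<bullet> (ys s (best s) - ybars s i) \<le> 0"]
    by (simp add: n_cut_def)
qed (simp add: n_cut_def)

lemma invar_n_cut_separates:
  assumes "invar s" and "i \<in> Ss s"
  shows "n_cut A s i \<bullet> (ys s i - ybars s i) > 0"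
  using assms invar_Ss_neq by (simp add: invar_n_cut)

text \<open>Every constraint of LB-MILP is valid at \<open>z\<close> with \<open>\<eta>\<close>
  equal to its objective: linearizations and Benders cuts underestimate, and \<open>snd z\<close>
  lies in \<open>relaxed_feasible\<close>. Thus a minimal value bounds the MINLP from below, and an
  infeasible master problem proves the MINLP infeasible.\<close>

lemma milp_feasible_relaxation:
  assumes inv: "invar s" and z: "minlp_feasible P z"
  shows "milp_feasible P A s (ereal (obj P z), z)"
proof -
  have zX: "z \<in> Xset P \<times> Yrel P" and c: "constr P z" and zY: "snd z \<in> Yint P"
    using z Yint_subset by (auto simp: minlp_feasible_def mem_Times_iff)
  have "lin (obj P) (zbest s) z \<le> obj P z \<and> lin_cons P s z" if b: "best s \<in> Ts s"
  proof -
    have zb: "zbest s \<in> Xset P \<times> Yrel P"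
      using invar_Ts_feasible[OF inv b] Yint_subset by (auto simp: zbest_def)
    then have "lin (ineq P i) (zbest s) z \<le> 0" if "i < n_ineq P" for i
      using lin_ineq_le[OF that zb zX] c that by (force simp: constr_def)
    then show ?thesis
      using lin_obj_le[OF zb zX] c by (simp add: lin_cons_def lin_eqc constr_def)
  qed
  moreover have "n_cut A s i \<bullet> (snd z - ybars s i) \<le> 0" if "i \<in> Ss s" for i
  proof -
    have "snd z \<in> relaxed_feasible"
      using zX c by (auto simp: relaxed_feasible_iff)
    then show ?thesis
      using invar_Ss_cut[OF inv that] by (simp add: invar_n_cut[OF inv that])
  qed
  ultimately show ?thesis
    using zX zY invar_cut_valid[OF inv _ z] invar_g_cut[OF inv]
    by (auto simp: milp_feasible_def)
qed

section \<open>Exclusion of visited integer points\<close>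

lemma br_feasible_new:
  assumes inv: "invar s" and ph: "phase s = Master" and z: "br_feasible P A s z"
    and less: "LB s < UB s"
  shows "snd z \<notin> ys s ` {..iter s}"
proof
  assume "snd z \<in> ys s ` {..iter s}"
  then obtain i where i: "i \<in> Ts s \<union> Ss s" "snd z = ys s i"
    using invar_index[OF inv] ph by auto
  show False
  proof (cases "i \<in> Ss s")
    case True
    then show False
      using z invar_n_cut_separates[OF inv] i(2) by (force simp: br_feasible_def)
  next
    case False
    then have T: "i \<in> Ts s" using i by simp
    then have b: "best s \<in> Ts s" "J P (ys s (best s)) \<le> J P (ys s i)" "UB s = J P (ys s (best s))"
      using invar_best[OF inv T] by auto
    let ?u = "obj P (xs s (best s), ys s (best s))"
    have Jb: "J P (ys s (best s)) = ereal ?u"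
      by (rule invar_J[OF inv b(1)])
    \<comment> \<open>\<open>Jbar\<close> averages \<open>UB\<close> and a smaller \<open>LB\<close>
      with weight \<open>1 - alph A > 0\<close> on the latter; for \<open>LB = -\<infinity>\<close>
      it is \<open>-\<infinity>\<close>.\<close>
    have "Jbar P A s < UB s"
    proof (cases "LB s")
      case (real l)
      then have "(1 - alph A) * l < (1 - alph A) * ?u"
        using less b(3) Jb alph by (intro mult_strict_left_mono) auto
      then show ?thesis
        using real b(3) Jb by (simp add: Jbar_def algebra_simps)
    next
      case PInf
      then show ?thesis using less by simp
    next
      case MInf
      then show ?thesis using b(3) Jb alph by (simp add: Jbar_def)
    qed
    moreover have "J P (ys s i) \<le> Jbar P A s"
      using z T i(2) by (auto simp: br_feasible_def)
    ultimately show False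
      using b by auto
  qed
qed

text \<open>For an index other than \<open>best s\<close>, the slope term of its Benders cut
  vanishes at its own point. The best index has no such cut in LB-MILP; there the KKT conditions
  show that no point with the same \<open>y\<close> and satisfying the linearized constraints lowers
  the linearized objective.\<close>

lemma milp_feasible_revisit:
  assumes inv: "invar s" and ph: "phase s = Master" and w: "milp_feasible P A s (V, z)"
    and old: "snd z \<in> ys s ` {..iter s}"
  shows "UB s \<le> V"
proof -
  obtain i where i: "i \<in> Ts s \<union> Ss s" "snd z = ys s i"
    using invar_index[OF inv] ph old by auto
  have "i \<notin> Ss s"
    using w invar_n_cut_separates[OF inv] i(2) by (force simp: milp_feasible_def)
  then have T: "i \<in> Ts s" using i by simp
  then have b: "best s \<in> Ts s" "J P (ys s (best s)) \<le> J P (ys s i)" "UB s = J P (ys s (best s))"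
    using invar_best[OF inv T] by auto
  show ?thesis
  proof (cases "i = best s")
    case False
    then have "J P (ys s i) + ereal (g_cut P A s i \<bullet> (snd z - ys s i)) \<le> V"
      using w T by (auto simp: milp_feasible_def)
    then have "J P (ys s i) \<le> V"
      using i(2) by simp
    with b show ?thesis by simp
  next
    case True
    obtain lam mu where k: "kkt P (xs s i) (ys s i) lam mu (- dJs s i)"
      using invar_Ts_kkt[OF inv T] by blast
    have "lin_cons P s z" "fst z \<in> Xset P" and V: "ereal (lin (obj P) (zbest s) z) \<le> V"
      using w b(1) by (auto simp: milp_feasible_def)
    then have "obj P (xs s i, ys s i) + (- (- dJs s i)) \<bullet> (snd z - ys s i)
        \<le> lin (obj P) (xs s i, ys s i) (fst z, snd z)"
      using True by (intro kkt_lin_obj_ge[OF k]) (auto simp: lin_cons_def zbest_def)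
    moreover have "snd z - ys s i = 0"
      using i(2) by simp
    ultimately have "obj P (zbest s) \<le> lin (obj P) (zbest s) z"
      using True by (simp add: zbest_def)
    then have "UB s \<le> ereal (lin (obj P) (zbest s) z)"
      using b(3) invar_J[OF inv b(1)] by (simp add: zbest_def)
    with V show ?thesis by simp
  qed
qed

section \<open>Preservation of the invariant\<close>

lemma invar_initial:
  assumes init: "initial P s"
  shows "invar s"
proof -
  have "LB s \<le> ereal (obj P z)" if z: "minlp_feasible P z" for z
  proof -
    have "LB s = (INF y\<in>Yrel P. J P y)"
      using init by (simp add: initial_def)
    also have "\<dots> \<le> J P (snd z)"
      using z Yint_subset by (intro INF_lower) (auto simp: minlp_feasible_def)
    also have "\<dots> \<le> ereal (obj P z)"
      using J_le[of P "snd z" "fst z"] z by (simp add: minlp_feasible_def nlp_feasible_def)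
    finally show ?thesis .
  qed
  then show ?thesis
    using init unfolding initial_def invar_def by auto
qed

lemma invar_nlp_feas:
  assumes inv: "invar s" and ph: "phase s = Evaluate" and less: "LB s < UB s"
    and sol: "nlp_solution P (ys s (iter s)) x" and k: "kkt P x (ys s (iter s)) lam mu muy"
  shows "invar (refresh P
           (s\<lparr>xs := (xs s)(iter s := x), dJs := (dJs s)(iter s := - muy),
              Ts := insert (iter s) (Ts s),
              UB := (if J P (ys s (iter s)) < UB s then J P (ys s (iter s)) else UB s)\<rparr>))"
    (is "invar (refresh P ?s)")
proof -
  have TS: "Ts s \<union> Ss s = {..<iter s}"
    using invar_index[OF inv] ph by simp
  then have fin: "finite (Ts ?s)"
    using finite_subset[of "Ts s" "{..<iter s}"] by auto
  have ne: "Ts ?s \<noteq> {}" by simp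
  have y: "inj_on (ys s) {..iter s}" "ys s ` {..iter s} \<subseteq> Yint P"
    using invar_distinct[OF inv] less by auto
  define b where "b = best_index P ?s"
  have b: "b \<in> insert (iter s) (Ts s)"
    "\<And>i. i \<in> insert (iter s) (Ts s) \<Longrightarrow> J P (ys s b) \<le> J P (ys s i)"
    using best_index_in_Ts[OF fin ne, where P = P] by (auto simp: b_def)
  \<comment> \<open>The old \<open>UB\<close> is the minimum over the old \<open>Ts\<close>, so the
    running minimum agrees with the value at the recomputed best index.\<close>
  have UB: "(if J P (ys s (iter s)) < UB s then J P (ys s (iter s)) else UB s) = J P (ys s b)"
  proof (cases "Ts s = {}")
    case True
    then show ?thesis
      using invar_UB_infinite[OF inv] b(1) by auto
  next
    case False
    then have o: "best s \<in> Ts s" "\<And>i. i \<in> Ts s \<Longrightarrow> J P (ys s (best s)) \<le> J P (ys s i)"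
      "UB s = J P (ys s (best s))"
      using invar_best[OF inv] by blast+
    show ?thesis
      using b(1) b(2)[of "iter s"] b(2)[of "best s"] o(2)[of b] o(1,3) by auto
  qed
  define s' where "s' = refresh P ?s"
  have fields: "phase s' = Master" "iter s' = iter s" "ys s' = ys s" "ybars s' = ybars s"
    "xs s' = (xs s)(iter s := x)" "dJs s' = (dJs s)(iter s := - muy)"
    "Ts s' = insert (iter s) (Ts s)" "Ss s' = Ss s" "best s' = b" "LB s' = LB s"
    "UB s' = (if J P (ys s (iter s)) < UB s then J P (ys s (iter s)) else UB s)"
    by (simp_all add: s'_def b_def refresh_def)
  have "invar s'"
  proof (rule invarI; unfold fields)
    show "insert (iter s) (Ts s) \<union> Ss s
        = (if Master = Evaluate then {..<iter s} else {..iter s})"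
      by (simp add: TS atMost_insert)
    show "\<exists>lam mu. kkt P (((xs s)(iter s := x)) i) (ys s i) lam mu (- ((dJs s)(iter s := - muy)) i)"
      if i: "i \<in> insert (iter s) (Ts s)" for i
      using invar_Ts_kkt[OF inv, of i] i k by (cases "i = iter s") auto
    show "nlp_solution P (ys s i) (((xs s)(iter s := x)) i)" if "i \<in> insert (iter s) (Ts s)" for i
      using invar_Ts_solution[OF inv, of i] that sol by auto
    show "ys s i \<in> Yint P" if "i \<in> insert (iter s) (Ts s)" for i
      using invar_Ts_Yint[OF inv, of i] that y by auto
  qed (use b UB y invar_Ss_neq[OF inv] invar_Ss_cut[OF inv] invar_LB_ge[OF inv]
      invar_LB_le[OF inv] in auto)
  then show ?thesis
    unfolding s'_def .
qed

lemma invar_nlp_infeas: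
  assumes inv: "invar s" and ph: "phase s = Evaluate" and less: "LB s < UB s"
    and infeas: "\<nexists>x. nlp_feasible P (ys s (iter s)) x" and sol: "fnlp_solution P s (x, yb)"
  shows "invar (refresh P
           (s\<lparr>xs := (xs s)(iter s := x), ybars := (ybars s)(iter s := yb),
              Ss := insert (iter s) (Ss s)\<rparr>))"
    (is "invar (refresh P ?s)")
proof -
  have TS: "Ts s \<union> Ss s = {..<iter s}"
    using invar_index[OF inv] ph by simp
  then have fin: "finite (Ts ?s)"
    using finite_subset[of "Ts s" "{..<iter s}"] by auto
  have y: "inj_on (ys s) {..iter s}" "ys s ` {..iter s} \<subseteq> Yint P"
    using invar_distinct[OF inv] less by auto
  have "ys s (best s) \<in> relaxed_feasible" if "Ts s \<noteq> {}"
    using invar_Ts_feasible(4)[OF inv] invar_best(1)[OF inv] that by blast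
  note cut = fnlp_solution_cut[OF sol infeas this]
  define b where "b = best_index P ?s"
  have b: "b \<in> Ts s" "\<And>i. i \<in> Ts s \<Longrightarrow> J P (ys s b) \<le> J P (ys s i)" if "Ts s \<noteq> {}"
    using best_index_in_Ts[OF fin, where P = P] that by (auto simp: b_def)
  \<comment> \<open>The recomputed best index may be another one, but both minimize over the same
    \<open>Ts\<close>.\<close>
  have UB: "UB s = J P (ys s b)" if "Ts s \<noteq> {}"
    using invar_best[OF inv b(1)[OF that]] b(2)[OF that] by (auto intro!: antisym)
  define s' where "s' = refresh P ?s"
  have fields: "phase s' = Master" "iter s' = iter s" "ys s' = ys s" "dJs s' = dJs s"
    "xs s' = (xs s)(iter s := x)" "ybars s' = (ybars s)(iter s := yb)"
    "Ts s' = Ts s" "Ss s' = insert (iter s) (Ss s)" "best s' = b" "LB s' = LB s" "UB s' = UB s"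
    by (simp_all add: s'_def b_def refresh_def)
  \<comment> \<open>Before this iteration the index sets lie strictly below \<open>iter s\<close>,
    so overwriting that entry leaves stored solutions intact.\<close>
  have xs: "((xs s)(iter s := x)) i = xs s i" if "i \<in> Ts s" for i
    using TS that by auto
  have "invar s'"
  proof (rule invarI; unfold fields)
    show "Ts s \<union> insert (iter s) (Ss s)
        = (if Master = Evaluate then {..<iter s} else {..iter s})"
      by (simp add: TS atMost_insert)
    show "\<exists>lam mu. kkt P (((xs s)(iter s := x)) i) (ys s i) lam mu (- dJs s i)" if "i \<in> Ts s" for i
      using invar_Ts_kkt[OF inv that] by (simp only: xs[OF that])
    show "nlp_solution P (ys s i) (((xs s)(iter s := x)) i)" if "i \<in> Ts s" for i
      using invar_Ts_solution[OF inv that] by (simp only: xs[OF that])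
    show "ys s i \<noteq> ((ybars s)(iter s := yb)) i" if "i \<in> insert (iter s) (Ss s)" for i
      using invar_Ss_neq[OF inv, of i] that cut(1) by auto
    show "(ys s i - ((ybars s)(iter s := yb)) i) \<bullet> (c - ((ybars s)(iter s := yb)) i) \<le> 0"
      if "i \<in> insert (iter s) (Ss s)" "c \<in> relaxed_feasible" for i c
      using invar_Ss_cut[OF inv, of i c] that cut(2)[of c] by auto
    show "inj_on (ys s) {..iter s} \<and> ys s ` {..iter s} \<subseteq> Yint P"
      using y ..
  qed (use b UB invar_Ts_Yint[OF inv] invar_UB_infinite[OF inv] invar_LB_ge[OF inv]
      invar_LB_le[OF inv] in auto)
  then show ?thesis
    unfolding s'_def .
qed

text \<open>Common to all rules of phase \<open>Master\<close>, with \<open>l\<close> the lower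
  bound after the rule. Novelty of \<open>y\<close> is demanded only while the gap stays
  open.\<close>

lemma invar_advance:
  assumes inv: "invar s" and ph: "phase s = Master" and "LB s \<le> l"
    and feas: "\<And>z. minlp_feasible P z \<Longrightarrow> l \<le> ereal (obj P z)"
    and new: "l < UB s \<Longrightarrow> y \<in> Yint P - ys s ` {..iter s}"
  shows "invar (advance y (s\<lparr>LB := l\<rparr>))"
proof -
  have TS: "Ts s \<union> Ss s = {..iter s}"
    using invar_index[OF inv] ph by simp
  have le: "i \<le> iter s" if "i \<in> Ts s \<or> i \<in> Ss s" for i
    using TS that by auto
  have neq: "i \<noteq> Suc (iter s)" if "i \<in> Ts s \<or> i \<in> Ss s" for i
    using le[OF that] by simp
  have y: "inj_on (ys s) {..iter s}" "ys s ` {..iter s} \<subseteq> Yint P"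
    using invar_distinct[OF inv] ph by auto
  let ?ys = "(ys s)(Suc (iter s) := y)"
  have same: "?ys i = ys s i" if "i \<in> Ts s \<or> i \<in> Ss s" for i
    using neq[OF that] by simp
  have img: "?ys ` {..iter s} = ys s ` {..iter s}"
    by (intro image_cong) auto
  have "inj_on ?ys {..Suc (iter s)} \<and> ?ys ` {..Suc (iter s)} \<subseteq> Yint P" if "l < UB s"
  proof -
    have "inj_on ?ys {..iter s}"
      using y(1) by (subst inj_on_cong[where g = "ys s"]) auto
    then show ?thesis
      using new[OF that] y(2) img by (auto simp: atMost_Suc simp del: fun_upd_apply)
        (auto simp: fun_upd_apply split: if_splits)
  qed
  note distinct = this
  have best: "best s \<in> Ts s" if "Ts s \<noteq> {}"
    using invar_best(1)[OF inv] that by blast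
  define s' where "s' = advance y (s\<lparr>LB := l\<rparr>)"
  have fields: "phase s' = Evaluate" "iter s' = Suc (iter s)" "ys s' = ?ys" "dJs s' = dJs s"
    "xs s' = xs s" "ybars s' = ybars s" "Ts s' = Ts s" "Ss s' = Ss s" "best s' = best s"
    "LB s' = l" "UB s' = UB s"
    by (simp_all add: s'_def advance_def)
  have "invar s'"
  proof (rule invarI; unfold fields)
    show "Ts s \<union> Ss s
        = (if Evaluate = Evaluate then {..<Suc (iter s)} else {..Suc (iter s)})"
      by (simp add: TS lessThan_Suc_atMost)
    show "?ys i \<in> Yint P" if "i \<in> Ts s" for i
      using invar_Ts_Yint[OF inv that] same that by simp
    show "nlp_solution P (?ys i) (xs s i)" if "i \<in> Ts s" for i
      using invar_Ts_solution[OF inv that] same that by simp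
    show "\<exists>lam mu. kkt P (xs s i) (?ys i) lam mu (- dJs s i)" if "i \<in> Ts s" for i
      using invar_Ts_kkt[OF inv that] same that by simp
    show "?ys i \<noteq> ybars s i" if "i \<in> Ss s" for i
      using invar_Ss_neq[OF inv that] same that by simp
    show "(?ys i - ybars s i) \<bullet> (c - ybars s i) \<le> 0" if "i \<in> Ss s" "c \<in> relaxed_feasible" for i c
      using invar_Ss_cut[OF inv that] same that by simp
    show "UB s = J P (?ys (best s))" if "Ts s \<noteq> {}"
      using invar_best(2)[OF inv best[OF that]] same best[OF that] by simp
    show "J P (?ys (best s)) \<le> J P (?ys i)" if "i \<in> Ts s" for i
      using invar_best(3)[OF inv that] invar_best(1)[OF inv that] same that by simp
    show "(INF y\<in>Yrel P. J P y) \<le> l"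
      using invar_LB_ge[OF inv] \<open>LB s \<le> l\<close> by (rule order_trans)
    show "inj_on ?ys {..Suc (iter s)} \<and> ?ys ` {..Suc (iter s)} \<subseteq> Yint P"
      if "Evaluate = Master \<or> l < UB s"
      using distinct that by simp
  qed (use best feas invar_UB_infinite[OF inv] in auto)
  then show ?thesis
    unfolding s'_def .
qed

lemma invar_step:
  assumes inv: "invar s" and step: "step P A s s'"
  shows "invar s'"
  using step
proof cases
  case (nlp_feas x lam mu muy)
  then show ?thesis using invar_nlp_feas[OF inv] by simp
next
  case (nlp_infeas x yb)
  then show ?thesis using invar_nlp_infeas[OF inv] by simp
next
  case (br x y)
  have "br_feasible P A s (x, y)"
    using br by (simp add: br_solution_def is_arg_min_def)
  \<comment> \<open>BR-MIQP leaves \<open>LB\<close> alone; the trivial update brings the state into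
    the shape of \<open>invar_advance\<close>.\<close>
  then have "invar (advance y (s\<lparr>LB := LB s\<rparr>))"
    using br br_feasible_new[OF inv, of "(x, y)"] invar_LB_le[OF inv]
    by (intro invar_advance[OF inv]) (auto simp: br_feasible_def)
  then show ?thesis using br by simp
next
  case (milp V x y)
  let ?l = "if V > LB s then V else LB s"
  have w: "milp_feasible P A s (V, x, y)"
    and opt: "\<And>w. milp_feasible P A s w \<Longrightarrow> V \<le> fst w"
    using milp unfolding milp_solution_def is_arg_min_def by (auto simp only: not_less fst_conv)
  have V: "V \<le> ereal (obj P z)" if "minlp_feasible P z" for z
    using opt[OF milp_feasible_relaxation[OF inv that]] by simp
  have "y \<in> Yint P - ys s ` {..iter s}" if l: "?l < UB s"
  proof -
    \<comment> \<open>A revisited point would push \<open>V\<close> up to \<open>UB\<close> and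
      close the gap.\<close>
    have "\<not> UB s \<le> V"
      using l by (auto split: if_splits)
    then show ?thesis
      using milp_feasible_revisit[OF inv _ w] milp w by (auto simp: milp_feasible_def)
  qed
  then show ?thesis
    unfolding milp(1) using milp V invar_LB_le[OF inv]
    by (intro invar_advance[OF inv]) auto
next
  case (milp_infeas y)
  \<comment> \<open>With the bound set to infinity the gap is closed, so the arbitrary
    \<open>y\<close> needs no novelty.\<close>
  have "\<not> minlp_feasible P z" for z
    using milp_feasible_relaxation[OF inv] milp_infeas by blast
  then show ?thesis
    unfolding milp_infeas(1) using milp_infeas
    by (intro invar_advance[OF inv]) auto
qed

lemma invar_reachable: "reachable P A s \<Longrightarrow> invar s"
proof -
  assume "reachable P A s"
  then obtain s0 where "initial P s0" "(step P A)\<^sup>*\<^sup>* s0 s"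
    by (auto simp: reachable_def)
  from this(2,1) show "invar s"
    by induction (auto intro: invar_initial invar_step)
qed

lemma step_phase:
  assumes "step P A s s'"
  shows "phase s = Evaluate \<Longrightarrow> LB s < UB s \<and> phase s' = Master \<and> iter s' = iter s"
    and "phase s = Master \<Longrightarrow> phase s' = Evaluate \<and> iter s' = Suc (iter s)"
  using assms by (cases; simp add: refresh_def advance_def)+

section \<open>Termination, correctness and progress\<close>

text \<open>Phases alternate, so every second state starts an iteration, and passing the guard there
  certifies distinct integer points.\<close>

lemma no_infinite_run:
  assumes init: "initial P (\<sigma> 0)" and run: "\<And>n. step P A (\<sigma> n) (\<sigma> (Suc n))"
  shows False
proof -
  have inv: "invar (\<sigma> n)" for n
    by (induction n) (auto intro: invar_initial init invar_step run)
  have it: "phase (\<sigma> (2 * n)) = Evaluate \<and> iter (\<sigma> (2 * n)) = n" for n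
  proof (induction n)
    case 0
    then show ?case using init by (simp add: initial_def)
  next
    case (Suc n)
    then show ?case
      using step_phase(1)[OF run[of "2 * n"]] step_phase(2)[OF run[of "Suc (2 * n)"]] by simp
  qed
  \<comment> \<open>Indices run from 0 to \<open>?n\<close> inclusive, which is one point more than
    \<open>Yint P\<close> contains.\<close>
  let ?n = "card (Yint P)"
  let ?s = "\<sigma> (2 * ?n)"
  have "LB ?s < UB ?s" "iter ?s = ?n"
    using it[of ?n] step_phase(1)[OF run[of "2 * ?n"]] by auto
  then have "inj_on (ys ?s) {..?n}" "ys ?s ` {..?n} \<subseteq> Yint P"
    using invar_distinct[OF inv[of "2 * ?n"]] by auto
  then have "card {..?n} \<le> card (Yint P)"
    using card_inj_on_le finY by blast
  then show False by simp
qed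

lemma terminated_correct:
  assumes inv: "invar s" and stop: "terminated s"
  shows "(is_arg_min (obj P) (minlp_feasible P) (zbest s) \<and> UB s = ereal (obj P (zbest s))) \<or>
         (LB s = \<infinity> \<and> UB s = \<infinity> \<and> (\<nexists>z. minlp_feasible P z))"
proof -
  have le: "UB s \<le> LB s"
    using stop by (simp add: terminated_def not_less)
  have LB: "LB s \<le> ereal (obj P z)" if "minlp_feasible P z" for z
    using invar_LB_le[OF inv that] .
  show ?thesis
  proof (cases "Ts s = {}")
    case True
    then have "UB s = \<infinity>"
      by (rule invar_UB_infinite[OF inv])
    with le LB show ?thesis by force
  next
    case False
    then have b: "best s \<in> Ts s" "UB s = J P (ys s (best s))"
      using invar_best[OF inv] by blast+
    then have UB: "UB s = ereal (obj P (zbest s))"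
      using invar_J[OF inv] by (simp add: zbest_def)
    have "minlp_feasible P (zbest s)"
      using invar_Ts_feasible[OF inv b(1)] by (simp add: minlp_feasible_def zbest_def)
    moreover have "obj P (zbest s) \<le> obj P z" if "minlp_feasible P z" for z
      using order_trans[OF le LB[OF that]] UB by simp
    ultimately show ?thesis
      using UB by (force simp: is_arg_min_def)
  qed
qed

text \<open>Without a feasible iterate, the relaxation value lies below \<open>LB\<close>, hence
  below infinity, and yields a relaxed feasible point. Otherwise the best point has distance zero to
  the center of its ball.\<close>

lemma fnlp_feasible_exists:
  assumes inv: "invar s" and less: "LB s < UB s"
  shows "\<exists>z. fnlp_feasible P s z"
proof (cases "Ts s = {}")
  case True
  have "(INF y\<in>Yrel P. J P y) < \<infinity>"
    using less_le_trans[OF le_less_trans[OF invar_LB_ge[OF inv] less], of \<infinity>] by simp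
  then obtain y where "y \<in> Yrel P" "J P y < \<infinity>"
    unfolding INF_less_iff by blast
  moreover from this(2) obtain x where "nlp_feasible P y x"
    unfolding J_def INF_less_iff by blast
  ultimately have "fnlp_feasible P s (x, y)"
    using True by (simp add: fnlp_feasible_def nlp_feasible_def)
  then show ?thesis ..
next
  case False
  then have "best s \<in> Ts s"
    using invar_best(1)[OF inv] by blast
  then have "fnlp_feasible P s (xs s (best s), ys s (best s))"
    using invar_Ts_feasible[OF inv] Yint_subset by (auto simp: fnlp_feasible_def)
  then show ?thesis ..
qed

lemma progress:
  assumes inv: "invar s" and nt: "\<not> terminated s" and att: "subproblems_attained P A s"
  shows "\<exists>s'. step P A s s'"
proof (cases "phase s")
  case Evaluate
  then have less: "LB s < UB s"
    using nt by (simp add: terminated_def)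
  show ?thesis
  proof (cases "\<exists>x. nlp_feasible P (ys s (iter s)) x")
    case True
    then obtain x where x: "nlp_solution P (ys s (iter s)) x"
      using att Evaluate by (auto simp: subproblems_attained_def)
    have "ys s (iter s) \<in> Yint P"
      using invar_distinct[OF inv] less by auto
    then obtain lam mu muy where "kkt P x (ys s (iter s)) lam mu muy"
      using kkt_exists x by blast
    then show ?thesis
      using step.nlp_feas[OF Evaluate less x] by blast
  next
    case False
    then have "\<exists>z. fnlp_solution P s z"
      using att Evaluate fnlp_feasible_exists[OF inv less]
      by (auto simp: subproblems_attained_def simp del: split_paired_Ex split_paired_All)
    then obtain x yb where "fnlp_solution P s (x, yb)"
      by (metis surj_pair)
    then show ?thesis
      using step.nlp_infeas[OF Evaluate less False] by blast
  qed
next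
  case Master
  show ?thesis
  proof (cases "needs_milp P A s")
    case True
    show ?thesis
    proof (cases "\<exists>w. milp_feasible P A s w")
      case t: True
      then obtain V x y where "milp_solution P A s (V, x, y)"
        using att Master True by (auto simp: subproblems_attained_def)
      then show ?thesis
        using step.milp[OF Master True] by blast
    next
      case False
      then show ?thesis
        using step.milp_infeas[OF Master True] by blast
    qed
  next
    case False
    then obtain x y where "br_solution P A s (x, y)"
      using att Master by (auto simp: subproblems_attained_def)
    moreover have "iter s - best s \<le> 1"
      using False by (auto simp: needs_milp_def)
    ultimately show ?thesis
      using step.br[OF Master] by blast
  qed
qed

end

text \<open>For a nondeterministic relation, absence of infinite runs could also mean getting stuck;
  the last conjunct rules this out whenever the called subproblems attain their minima.\<close>

theorem theorem2:
  fixes P :: "('nx::finite, 'ny::finite) minlp"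
    and A :: "('nx, 'ny) params"
  assumes "polyhedron (Xset P)" and "polyhedron (Yrel P)" and "finite (Yint P)"
    and "C2 (obj P)"
    and "\<And>i. i < n_ineq P \<Longrightarrow> C2 (ineq P i)"
    and "\<And>j. j < n_eq P \<Longrightarrow> C2 (eqc P j)"
    and "\<And>y x. y \<in> Yint P \<Longrightarrow> nlp_solution P y x \<Longrightarrow> mfcq P y x"
    and "\<And>j. j < n_eq P \<Longrightarrow> affine_map (eqc P j)"
    and "\<And>i. i < n_ineq P \<Longrightarrow> convex_on (Xset P \<times> Yrel P) (ineq P i)"
    and "convex_on (Xset P \<times> Yrel P) (obj P)"
    and "sym_pos_def (weight A)" and "amp A \<ge> 1" and "0 \<le> alph A" and "alph A < 1"
    and "\<And>i. sym_pos_semidef (hess A i)"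
  shows "(\<nexists>\<sigma>. initial P (\<sigma> 0) \<and> (\<forall>n. step P A (\<sigma> n) (\<sigma> (Suc n)))) \<and>
    (\<forall>s. reachable P A s \<and> terminated s \<longrightarrow>
       (is_arg_min (obj P) (minlp_feasible P) (zbest s) \<and> UB s = ereal (obj P (zbest s))) \<or>
       (LB s = \<infinity> \<and> UB s = \<infinity> \<and> (\<nexists>z. minlp_feasible P z))) \<and>
    (\<forall>s. reachable P A s \<and> \<not> terminated s \<and> subproblems_attained P A s \<longrightarrow>
       (\<exists>s'. step P A s s'))"
proof -
  interpret convex_minlp P A
    using assms by unfold_locales
  show ?thesis
    using no_infinite_run terminated_correct progress invar_reachable by blast
qed

end
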